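(* Let $\mathscr{P}$ be a closed hereditary topological property preserved under finite closed sums, and let $X$ be a normal locally-$\mathscr{P}$ space. Then $C_{\mathscr{P}}(X)$ is a normed subalgebra of $C_b(X)$ isometrically isomorphic (as a normed algebra) to $C_c(Y)$ for some locally compact space $Y$, unique up to homeomorphism, namely $Y=\lambda_{\mathscr{P}}X$. Furthermore, $C_{\mathscr{P}}(X)$ is unital if and only if $X$ has $\mathscr{P}$.
   Context: The scalar field is fixed and is either $\mathbb{R}$ or $\mathbb{C}$. Spaces are topological spaces, assumed non-empty. Normal and completely regular spaces are assumed to be Hausdorff; compact and locally compact spaces are Hausdorff. A topological property is a property of spaces invariant under homeomorphism. $\mathscr{P}$ is closed hereditary if every closed subspace of a space with $\mathscr{P}$ has $\mathscr{P}$. $\mathscr{P}$ is preserved under finite closed sums if any space that is a finite union of closed subspaces each having $\mathscr{P}$ has $\mathscr{P}$. A $\mathscr{P}$-neighborhood of a point (or set) is a neighborhood of it (i.e. a set whose interior contains it) that, as a subspace, has $\mathscr{P}$. $X$ is locally-$\mathscr{P}$ if each of its points has a $\mathscr{P}$-neighborhood in $X$. $C_b(X)$ is the algebra of continuous bounded scalar-valued functions on $X$ with the supremum norm. For $f\in C_b(X)$, $\mathrm{Coz}(f)=\{x\in X: f(x)\neq 0\}$, $\mathrm{supp}(f)=\mathrm{cl}_X\mathrm{Coz}(f)$, and $\mathrm{Coz}(X)=\{\mathrm{Coz}(f):f\in C_b(X)\}$. $C_c(Y)$ is the set of $f\in C_b(Y)$ with compact support, with the supremum norm. Define $$C_{\mathscr{P}}(X)=\{f\in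 C_b(X):\mathrm{supp}(f)\text{ has a }\mathscr{P}\text{-neighborhood in }X\}.$$ For a completely regular space $X$ with Stone–Čech compactification $\beta X$, define the subspace $$\lambda_{\mathscr{P}}X=\bigcup\{\mathrm{int}_{\beta X}\mathrm{cl}_{\beta X}C: C\in\mathrm{Coz}(X)\text{ and }\mathrm{cl}_XC\text{ has }\mathscr{P}\}$$ of $\beta X$. *)

theory Defs
  imports "HOL-Analysis.Analysis"
begin

section \<open>Topological properties\<close>

text \<open>A property of spaces is a predicate on topologies over the carrier type of the space under
  consideration. By convention spaces are non-empty, so nothing is assumed about the value
  of a property at the empty topology.\<close>

definition topological_property :: "('a topology \<Rightarrow> bool) \<Rightarrow> bool" where
  "topological_property P \<longleftrightarrow>
     (\<forall>X Y. topspace X \<noteq> {} \<and> X homeomorphic_space Y \<and> P X \<longrightarrow> P Y)"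

definition closed_hereditary :: "('a topology \<Rightarrow> bool) \<Rightarrow> bool" where
  "closed_hereditary P \<longleftrightarrow>
     (\<forall>X C. P X \<and> closedin X C \<and> C \<noteq> {} \<longrightarrow> P (subtopology X C))"

definition preserved_under_finite_closed_sums :: "('a topology \<Rightarrow> bool) \<Rightarrow> bool" where
  "preserved_under_finite_closed_sums P \<longleftrightarrow>
     (\<forall>X \<C>. topspace X \<noteq> {} \<and> finite \<C> \<and> \<Union>\<C> = topspace X \<and>
        (\<forall>C\<in>\<C>. closedin X C \<and> C \<noteq> {} \<and> P (subtopology X C)) \<longrightarrow> P X)"

definition P_neighborhood :: "('a topology \<Rightarrow> bool) \<Rightarrow> 'a topology \<Rightarrow> 'a set \<Rightarrow> 'a set \<Rightarrow> bool" where
  "P_neighborhood P X S N \<longleftrightarrow>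
     N \<subseteq> topspace X \<and> N \<noteq> {} \<and> S \<subseteq> X interior_of N \<and> P (subtopology X N)"

definition locally_P :: "('a topology \<Rightarrow> bool) \<Rightarrow> 'a topology \<Rightarrow> bool" where
  "locally_P P X \<longleftrightarrow> (\<forall>x\<in>topspace X. \<exists>N. P_neighborhood P X {x} N)"

section \<open>Algebras of bounded continuous functions\<close>

text \<open>As in \<^const>\<open>cfunspace\<close>, a function on \<open>X\<close> is represented by a function that is
  \<^const>\<open>undefined\<close> outside \<open>topspace X\<close>; hence the restrictions in the pointwise operations.\<close>

definition C_b :: "'a topology \<Rightarrow> ('a \<Rightarrow> 'k::real_normed_field) set" where
  "C_b X = mspace (cfunspace X euclidean_metric)"

definition sup_norm :: "'a topology \<Rightarrow> ('a \<Rightarrow> 'k::real_normed_field) \<Rightarrow> real" where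
  "sup_norm X f = (SUP x\<in>topspace X. norm (f x))"

definition fun_zero :: "'a topology \<Rightarrow> 'a \<Rightarrow> 'k::real_normed_field" where
  "fun_zero X = (\<lambda>x\<in>topspace X. 0)"

definition fun_add ::
  "'a topology \<Rightarrow> ('a \<Rightarrow> 'k::real_normed_field) \<Rightarrow> ('a \<Rightarrow> 'k) \<Rightarrow> 'a \<Rightarrow> 'k" where
  "fun_add X f g = (\<lambda>x\<in>topspace X. f x + g x)"

definition fun_scale :: "'a topology \<Rightarrow> 'k::real_normed_field \<Rightarrow> ('a \<Rightarrow> 'k) \<Rightarrow> 'a \<Rightarrow> 'k" where
  "fun_scale X c f = (\<lambda>x\<in>topspace X. c * f x)"

definition fun_mult ::
  "'a topology \<Rightarrow> ('a \<Rightarrow> 'k::real_normed_field) \<Rightarrow> ('a \<Rightarrow> 'k) \<Rightarrow> 'a \<Rightarrow> 'k" where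
  "fun_mult X f g = (\<lambda>x\<in>topspace X. f x * g x)"

text \<open>The norm of a subalgebra of \<open>C_b X\<close> is always the restriction of \<open>sup_norm X\<close>.\<close>

definition subalgebra_of_C_b :: "'a topology \<Rightarrow> ('a \<Rightarrow> 'k::real_normed_field) set \<Rightarrow> bool" where
  "subalgebra_of_C_b X A \<longleftrightarrow>
     A \<subseteq> C_b X \<and> fun_zero X \<in> A \<and>
     (\<forall>f\<in>A. \<forall>g\<in>A. fun_add X f g \<in> A) \<and>
     (\<forall>c. \<forall>f\<in>A. fun_scale X c f \<in> A) \<and>
     (\<forall>f\<in>A. \<forall>g\<in>A. fun_mult X f g \<in> A)"

lemma subalgebra_of_C_b_C_b: "subalgebra_of_C_b X (C_b X :: ('a \<Rightarrow> 'k::real_normed_field) set)"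
proof -
  have bmult: "bounded ((\<lambda>x. f x * g x) ` S)"
    if b: "bounded (f ` S)" "bounded (g ` S)" for f g :: "'a \<Rightarrow> 'k" and S
  proof -
    obtain B where B: "B > 0" "\<And>x. x \<in> S \<Longrightarrow> norm (f x) \<le> B"
      using b(1) by (auto simp: bounded_pos)
    obtain C where C: "\<And>x. x \<in> S \<Longrightarrow> norm (g x) \<le> C"
      using b(2) by (auto simp: bounded_pos)
    have "norm (f x * g x) \<le> B * C" if "x \<in> S" for x
      using B C that by (simp add: norm_mult mult_mono)
    then show ?thesis by (auto simp: bounded_iff)
  qed
  have bconst: "bounded ((\<lambda>x. c) ` S)" for c :: 'k and S :: "'a set"
    by (auto simp: bounded_iff)
  have cmult: "continuous_map X euclidean (\<lambda>x. f x * g x)"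
    if "continuous_map X euclidean f" "continuous_map X euclidean g" for f g :: "'a \<Rightarrow> 'k"
    using that by (simp add: continuous_map_atin tendsto_mult)
  show ?thesis
    by (auto simp: subalgebra_of_C_b_def C_b_def fun_zero_def fun_add_def fun_scale_def fun_mult_def
        intro!: bconst bmult cmult bounded_plus_comp continuous_map_add)
qed

definition isometrically_isomorphic ::
  "'a topology \<Rightarrow> ('a \<Rightarrow> 'k::real_normed_field) set \<Rightarrow> 'b topology \<Rightarrow> ('b \<Rightarrow> 'k) set \<Rightarrow> bool" where
  "isometrically_isomorphic X A Y B \<longleftrightarrow>
     (\<exists>\<phi>. bij_betw \<phi> A B \<and>
        (\<forall>f\<in>A. \<forall>g\<in>A. \<phi> (fun_add X f g) = fun_add Y (\<phi> f) (\<phi> g)) \<and>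
        (\<forall>c. \<forall>f\<in>A. \<phi> (fun_scale X c f) = fun_scale Y c (\<phi> f)) \<and>
        (\<forall>f\<in>A. \<forall>g\<in>A. \<phi> (fun_mult X f g) = fun_mult Y (\<phi> f) (\<phi> g)) \<and>
        (\<forall>f\<in>A. sup_norm Y (\<phi> f) = sup_norm X f))"

definition unital :: "'a topology \<Rightarrow> ('a \<Rightarrow> 'k::real_normed_field) set \<Rightarrow> bool" where
  "unital X A \<longleftrightarrow> (\<exists>u\<in>A. \<forall>f\<in>A. fun_mult X u f = f \<and> fun_mult X f u = f)"

definition Coz :: "'a topology \<Rightarrow> ('a \<Rightarrow> 'k::real_normed_field) \<Rightarrow> 'a set" where
  "Coz X f = {x \<in> topspace X. f x \<noteq> 0}"

definition supp :: "'a topology \<Rightarrow> ('a \<Rightarrow> 'k::real_normed_field) \<Rightarrow> 'a set" where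
  "supp X f = X closure_of Coz X f"

definition cozero_sets :: "'k::real_normed_field itself \<Rightarrow> 'a topology \<Rightarrow> 'a set set" where
  "cozero_sets _ X = Coz X ` (C_b X :: ('a \<Rightarrow> 'k) set)"

definition C_c :: "'a topology \<Rightarrow> ('a \<Rightarrow> 'k::real_normed_field) set" where
  "C_c Y = {f \<in> C_b Y. compactin Y (supp Y f)}"

definition C_P :: "('a topology \<Rightarrow> bool) \<Rightarrow> 'a topology \<Rightarrow> ('a \<Rightarrow> 'k::real_normed_field) set" where
  "C_P P X = {f \<in> C_b X. \<exists>N. P_neighborhood P X (supp X f) N}"

section \<open>The Stone-Cech compactification\<close>

text \<open>\<open>\<beta>X\<close> is the closure of the image of \<open>X\<close> under the evaluation map into the cube indexed by
  all continuous functions from \<open>X\<close> to \<open>[0,1]\<close>.\<close>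

definition unit_interval_maps :: "'a topology \<Rightarrow> ('a \<Rightarrow> real) set" where
  "unit_interval_maps X = {f \<in> C_b X. f \<in> topspace X \<rightarrow> {0..1}}"

definition beta_embed :: "'a topology \<Rightarrow> 'a \<Rightarrow> ('a \<Rightarrow> real) \<Rightarrow> real" where
  "beta_embed X x = (\<lambda>f\<in>unit_interval_maps X. f x)"

definition cube :: "'a topology \<Rightarrow> (('a \<Rightarrow> real) \<Rightarrow> real) topology" where
  "cube X = product_topology (\<lambda>f. top_of_set {0..1}) (unit_interval_maps X)"

definition stone_cech :: "'a topology \<Rightarrow> (('a \<Rightarrow> real) \<Rightarrow> real) topology" where
  "stone_cech X = subtopology (cube X) (cube X closure_of (beta_embed X ` topspace X))"

lemma topspace_stone_cech:
  "topspace (stone_cech X) = cube X closure_of (beta_embed X ` topspace X)"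
  by (simp add: stone_cech_def closure_of_subset_topspace inf_absorb2)

lemma compact_Hausdorff_cube: "compact_space (cube X)" "Hausdorff_space (cube X)"
  by (auto simp: cube_def compact_space_product_topology Hausdorff_space_product_topology
      compact_space_subtopology Hausdorff_space_subtopology)

lemma compact_space_stone_cech: "compact_space (stone_cech X)"
  by (simp add: stone_cech_def closedin_compact_space compact_Hausdorff_cube(1)
      compact_space_subtopology)

lemma Hausdorff_space_stone_cech: "Hausdorff_space (stone_cech X)"
  by (simp add: stone_cech_def Hausdorff_space_subtopology compact_Hausdorff_cube)

lemma beta_embed_in_cube: "beta_embed X ` topspace X \<subseteq> topspace (cube X)"
proof (clarsimp simp: cube_def beta_embed_def)
  fix x f assume "x \<in> topspace X" "f \<in> unit_interval_maps X"
  then show "0 \<le> f x \<and> f x \<le> 1"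
    by (auto simp: unit_interval_maps_def Pi_iff)
qed

lemma beta_embed_image_subset: "beta_embed X ` topspace X \<subseteq> topspace (stone_cech X)"
  by (simp add: topspace_stone_cech closure_of_subset beta_embed_in_cube)

lemma beta_embed_dense:
  "stone_cech X closure_of (beta_embed X ` topspace X) = topspace (stone_cech X)"
  by (simp add: topspace_stone_cech stone_cech_def closure_of_subtopology_subset
      closure_of_subtopology closure_of_subset beta_embed_in_cube inf_absorb2
      closure_of_subset_topspace)

lemma embedding_map_beta_embed:
  assumes "completely_regular_space X" "Hausdorff_space X"
  shows "embedding_map X (stone_cech X) (beta_embed X)"
proof -
  have K: "mspace (submetric (cfunspace X euclidean_metric) {f. f \<in> topspace X \<rightarrow> {0..1::real}})
             = unit_interval_maps X"
    by (auto simp: unit_interval_maps_def C_b_def)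
  have "embedding_map X (cube X) (beta_embed X)"
    using completely_regular_space_cube_embedding_explicit[OF assms]
    unfolding K cube_def beta_embed_def[abs_def] .
  then show ?thesis
    using beta_embed_image_subset[of X]
    by (simp add: stone_cech_def embedding_map_in_subtopology topspace_stone_cech)
qed

lemma stone_cech_extension:
  assumes f: "f \<in> (C_b X :: ('a \<Rightarrow> real) set)"
  obtains g where "continuous_map (stone_cech X) euclidean g"
    "\<And>x. x \<in> topspace X \<Longrightarrow> g (beta_embed X x) = f x"
proof -
  have cf: "continuous_map X euclidean f" and bf: "bounded (f ` topspace X)"
    using f by (auto simp: C_b_def)
  obtain M where M: "M > 0" "\<And>x. x \<in> topspace X \<Longrightarrow> \<bar>f x\<bar> \<le> M"
    using bf by (auto simp: bounded_pos)
  define h where "h = (\<lambda>x\<in>topspace X. (f x + M) / (2 * M))"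
  have h01: "h \<in> topspace X \<rightarrow> {0..1}"
  proof
    fix x assume x: "x \<in> topspace X"
    then have "0 \<le> f x + M" "f x + M \<le> 2 * M" using M(2)[of x] by auto
    then show "h x \<in> {0..1}" using x M(1) by (simp add: h_def)
  qed
  have "continuous_map X euclidean (\<lambda>x. (f x + M) / (2 * M))"
    by (intro continuous_intros cf) (use M in auto)
  then have "continuous_map X euclidean h"
    by (rule continuous_map_eq) (simp add: h_def)
  moreover have "bounded (h ` topspace X)"
    using h01 by (auto intro: bounded_subset[OF bounded_closed_interval[of 0 1]])
  ultimately have hK: "h \<in> unit_interval_maps X"
    using h01 by (auto simp: unit_interval_maps_def C_b_def h_def)
  have "continuous_map (cube X) (top_of_set {0..1}) (\<lambda>y. y h)"
    unfolding cube_def by (rule continuous_map_product_projection[OF hK])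
  then have "continuous_map (stone_cech X) euclidean (\<lambda>y. y h)"
    unfolding stone_cech_def
    by (simp add: continuous_map_from_subtopology continuous_map_in_subtopology)
  then have "continuous_map (stone_cech X) euclidean (\<lambda>y. 2 * M * y h - M)"
    by (intro continuous_intros)
  moreover have "2 * M * beta_embed X x h - M = f x" if "x \<in> topspace X" for x
    using that hK M(1) by (simp add: beta_embed_def h_def)
  ultimately show thesis by (rule that)
qed

definition lambda_P ::
  "'k::real_normed_field itself \<Rightarrow> ('a topology \<Rightarrow> bool) \<Rightarrow> 'a topology
     \<Rightarrow> (('a \<Rightarrow> real) \<Rightarrow> real) topology" where
  "lambda_P \<kappa> P X = subtopology (stone_cech X)
     (\<Union>{stone_cech X interior_of (stone_cech X closure_of (beta_embed X ` C)) | C.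
          C \<in> cozero_sets \<kappa> X \<and> P (subtopology X (X closure_of C))})"

end

theory Submission
  imports Defs
begin

text \<open>
  A function in \<open>C_P P X\<close> vanishes outside a closed \<open>P\<close>-neighborhood, and by normality a cozero set
  with \<open>P\<close>-closure can be squeezed between its support and that neighborhood. Hence its extension to
  \<open>\<beta>X\<close> has compact support inside \<open>\<lambda>\<^sub>PX\<close>. Conversely a compact subset of \<open>\<lambda>\<^sub>PX\<close> is covered by finitely
  many of the defining open sets, and the union of the corresponding closures in \<open>X\<close> has \<open>P\<close>; so
  restriction to the dense subset \<open>X\<close> is a bijection from \<open>C_c (\<lambda>\<^sub>PX)\<close> onto \<open>C_P P X\<close>.
  Uniqueness holds because every nonzero character of \<open>C_c Y\<close> is evaluation at a point: an ideal
  without common zero contains, for each compact set, a sum of squared moduli that is positive there.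
\<close>

section \<open>Bounded continuous functions\<close>

lemma C_b_iff:
  "f \<in> C_b X \<longleftrightarrow> continuous_map X euclidean f \<and> bounded (f ` topspace X) \<and>
     f \<in> extensional (topspace X)"
  by (auto simp: C_b_def)

lemmas C_b_closed = subalgebra_of_C_b_C_b[unfolded subalgebra_of_C_b_def, THEN conjunct2]

lemma
  shows C_b_zero: "fun_zero X \<in> C_b X"
    and C_b_add: "f \<in> C_b X \<Longrightarrow> g \<in> C_b X \<Longrightarrow> fun_add X f g \<in> C_b X"
    and C_b_scale: "f \<in> C_b X \<Longrightarrow> fun_scale X c f \<in> C_b X"
    and C_b_mult: "f \<in> C_b X \<Longrightarrow> g \<in> C_b X \<Longrightarrow> fun_mult X f g \<in> C_b X"
  using C_b_closed by blast+

lemma C_b_eqI: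
  assumes "f \<in> C_b X" "g \<in> C_b X" "\<And>x. x \<in> topspace X \<Longrightarrow> f x = g x"
  shows "f = g"
  using assms by (auto simp: C_b_iff intro: extensionalityI)

lemma continuous_map_compose_on_UNIV:
  assumes "continuous_map X euclidean f" "continuous_on UNIV h"
  shows "continuous_map X euclidean (\<lambda>x. h (f x))"
  using continuous_map_compose[OF assms(1), of euclidean h] assms(2)
  by (simp add: o_def)

lemma restrict_in_C_b:
  assumes "continuous_map X euclidean f" "\<And>x. x \<in> topspace X \<Longrightarrow> norm (f x) \<le> B"
  shows "restrict f (topspace X) \<in> C_b X"
proof -
  have "continuous_map X euclidean (restrict f (topspace X))"
    by (rule continuous_map_eq[OF assms(1)]) simp
  moreover have "bounded (restrict f (topspace X) ` topspace X)"
    using assms(2) by (auto simp: bounded_iff)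
  ultimately show ?thesis
    by (simp add: C_b_iff)
qed

lemma C_b_norm_bound:
  assumes "f \<in> C_b X"
  obtains B where "B > 0" "\<And>x. x \<in> topspace X \<Longrightarrow> norm (f x) \<le> B"
  using assms by (auto simp: C_b_iff bounded_pos)

text \<open>Urysohn functions are real-valued; composing with \<open>of_real\<close> carries them to
  any scalar field, and by \<open>Coz_of_real\<close> the cozero set stays the same.\<close>

lemma of_real_in_C_b:
  assumes "u \<in> C_b X"
  shows "(\<lambda>x\<in>topspace X. of_real (u x) :: 'k::real_normed_field) \<in> C_b X"
proof -
  obtain B where "\<And>x. x \<in> topspace X \<Longrightarrow> norm (u x) \<le> B"
    using assms C_b_norm_bound by metis
  moreover have "continuous_map X euclidean (\<lambda>x. of_real (u x) :: 'k)"
    using assms by (intro continuous_map_compose_on_UNIV[where h = of_real])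
      (auto simp: C_b_iff intro!: continuous_intros)
  ultimately show ?thesis
    by (intro restrict_in_C_b) auto
qed

lemma Coz_of_real: "Coz X (\<lambda>x\<in>topspace X. of_real (u x) :: 'k::real_normed_field) = Coz X u"
  by (auto simp: Coz_def)

section \<open>Cozero sets and supports\<close>

lemma openin_Coz:
  assumes "continuous_map X euclidean f"
  shows "openin X (Coz X f)"
  using openin_continuous_map_preimage[OF assms, of "- {0}"]
  by (simp add: Coz_def open_Compl)

lemma Coz_subset_supp: "Coz X f \<subseteq> supp X f"
  by (auto simp: supp_def Coz_def intro!: closure_of_subset[THEN subsetD])

lemma closedin_supp: "closedin X (supp X f)"
  by (simp add: supp_def)

lemma supp_subset_closedin:
  assumes "closedin X C" "Coz X f \<subseteq> C"
  shows "supp X f \<subseteq> C"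
  by (simp add: assms supp_def closure_of_minimal)

lemma supp_mono: "Coz X f \<subseteq> Coz X g \<Longrightarrow> supp X f \<subseteq> supp X g"
  by (simp add: supp_def closure_of_mono)

lemma supp_fun_add: "supp X (fun_add X f g) \<subseteq> supp X f \<union> supp X g"
proof -
  have "Coz X (fun_add X f g) \<subseteq> Coz X f \<union> Coz X g"
    by (auto simp: Coz_def fun_add_def)
  then show ?thesis
    unfolding supp_def by (metis closure_of_Un closure_of_mono)
qed

lemma supp_fun_mult: "supp X (fun_mult X f g) \<subseteq> supp X f"
  by (rule supp_mono) (auto simp: Coz_def fun_mult_def)

lemma supp_fun_scale: "supp X (fun_scale X c f) \<subseteq> supp X f"
  by (rule supp_mono) (auto simp: Coz_def fun_scale_def)

lemma supp_fun_zero: "supp X (fun_zero X) = {}"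
  by (simp add: supp_def Coz_def fun_zero_def)

section \<open>Functions with compact support\<close>

lemma C_c_antimono:
  assumes "f \<in> C_c Y" "g \<in> C_b Y" "supp Y g \<subseteq> supp Y f"
  shows "g \<in> C_c Y"
  using assms closed_compactin[OF _ _ closedin_supp] by (auto simp: C_c_def)

lemma subalgebra_C_c: "subalgebra_of_C_b Y (C_c Y :: ('a \<Rightarrow> 'k::real_normed_field) set)"
  unfolding subalgebra_of_C_b_def
proof (intro conjI ballI allI)
  show "C_c Y \<subseteq> C_b Y"
    by (auto simp: C_c_def)
  show "fun_zero Y \<in> (C_c Y :: ('a \<Rightarrow> 'k) set)"
    by (simp add: C_c_def C_b_zero supp_fun_zero)
next
  fix f g :: "'a \<Rightarrow> 'k" assume fg: "f \<in> C_c Y" "g \<in> C_c Y"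
  have "compactin Y (supp Y f \<union> supp Y g)"
    using fg by (simp add: C_c_def compactin_Un)
  then show "fun_add Y f g \<in> C_c Y"
    using fg closed_compactin[OF _ supp_fun_add closedin_supp]
    by (auto simp: C_c_def C_b_add)
next
  fix f g :: "'a \<Rightarrow> 'k" assume fg: "f \<in> C_c Y" "g \<in> C_c Y"
  then show "fun_mult Y f g \<in> C_c Y"
    by (intro C_c_antimono[OF _ _ supp_fun_mult]) (auto simp: C_c_def C_b_mult)
next
  fix c and f :: "'a \<Rightarrow> 'k" assume "f \<in> C_c Y"
  then show "fun_scale Y c f \<in> C_c Y"
    by (intro C_c_antimono[OF _ _ supp_fun_scale]) (auto simp: C_c_def C_b_scale)
qed

lemma C_c_in_C_b: "f \<in> C_c Y \<Longrightarrow> f \<in> C_b Y"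
  by (simp add: C_c_def)

lemma
  assumes "f \<in> C_c Y"
  shows C_c_add: "g \<in> C_c Y \<Longrightarrow> fun_add Y f g \<in> C_c Y"
    and C_c_scale: "fun_scale Y c f \<in> C_c Y"
  using assms subalgebra_C_c[of Y] by (auto simp: subalgebra_of_C_b_def)

lemma C_c_mult: "f \<in> C_c Y \<Longrightarrow> g \<in> C_b Y \<Longrightarrow> fun_mult Y f g \<in> C_c Y"
  by (rule C_c_antimono[OF _ _ supp_fun_mult]) (auto simp: C_c_in_C_b C_b_mult)

text \<open>Local compactness supplies an open \<open>V\<close> around \<open>y\<close> with compact
  closure, and complete regularity a function separating \<open>y\<close> from the complement of
  \<open>U \<inter> V\<close>. These bumps later give nonzero characters, separation of points and a
  test for continuity.\<close>

lemma C_c_bump: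
  assumes lc: "locally_compact_space Y" and H: "Hausdorff_space Y"
    and U: "openin Y U" "y \<in> U"
  obtains g :: "'a \<Rightarrow> 'k::real_normed_field" where "g \<in> C_c Y" "g y = 1" "Coz Y g \<subseteq> U"
proof -
  have y: "y \<in> topspace Y"
    using U openin_subset by blast
  obtain V where V: "openin Y V" "compactin Y (Y closure_of V)" "y \<in> V"
    using lc H y locally_compact_space_compact_closure_of by metis
  have cr: "completely_regular_space Y"
    using lc H locally_compact_regular_imp_completely_regular_space by blast
  have W: "closedin Y (topspace Y - U \<inter> V)" "y \<in> topspace Y - (topspace Y - U \<inter> V)"
    using U V y by auto
  obtain f :: "'a \<Rightarrow> real" where f: "continuous_map Y (top_of_set {0..1}) f" "f y = 0"
      "f ` (topspace Y - U \<inter> V) \<subseteq> {1}"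
    using cr[unfolded completely_regular_space_def, rule_format, OF conjI[OF W]] by auto
  have f01: "f x \<in> {0..1}" if "x \<in> topspace Y" for x
    using f(1) that by (auto simp: continuous_map_in_subtopology)
  have cf: "continuous_map Y euclidean f"
    using f(1) by (simp add: continuous_map_in_subtopology)
  \<comment> \<open>\<open>f\<close> is 0 at \<open>y\<close> and 1 off \<open>U \<inter> V\<close>,
    so \<open>1 - f\<close> is 1 at \<open>y\<close> and vanishes off \<open>V\<close>; its support
    lies in the compact closure of \<open>V\<close>.\<close>
  define g :: "'a \<Rightarrow> 'k" where "g = (\<lambda>x\<in>topspace Y. of_real (1 - f x))"
  have "continuous_map Y euclidean (\<lambda>x. of_real (1 - f x) :: 'k)"
    by (rule continuous_map_compose_on_UNIV[OF cf]) (intro continuous_intros)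
  then have gb: "g \<in> C_b Y"
    unfolding g_def by (rule restrict_in_C_b[of _ _ 1]) (use f01 in \<open>auto simp del: of_real_diff\<close>)
  have Cg: "Coz Y g \<subseteq> U \<inter> V"
    using f(3) by (auto simp: Coz_def g_def)
  then have "supp Y g \<subseteq> Y closure_of V"
    unfolding supp_def by (intro closure_of_mono) auto
  then have "g \<in> C_c Y"
    using gb closed_compactin[OF V(2) _ closedin_supp] by (simp add: C_c_def)
  then show thesis
    using that Cg y f(2) by (auto simp: g_def)
qed

section \<open>Ideals and characters of \<open>C_c Y\<close>\<close>

text \<open>In \<open>\<real>\<close> and \<open>\<complex>\<close> this is conjugation; the formula is available in every normed field.\<close>

definition conjugate :: "'k::real_normed_field \<Rightarrow> 'k" where
  "conjugate x = (norm x)\<^sup>2 *\<^sub>R inverse x"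

lemma conjugate_mult: "x * conjugate x = of_real ((norm x)\<^sup>2)"
  by (cases "x = 0") (simp_all add: conjugate_def scaleR_conv_of_real)

lemma norm_conjugate: "norm (conjugate x) = norm x"
  by (cases "x = 0") (simp_all add: conjugate_def norm_inverse power2_eq_square)

lemma continuous_on_conjugate: "continuous_on UNIV (conjugate :: 'k::real_normed_field \<Rightarrow> 'k)"
proof -
  have "isCont conjugate x" for x :: 'k
  proof (cases "x = 0")
    case True
    have "((\<lambda>y::'k. norm y) \<longlongrightarrow> 0) (at 0)"
      by (intro tendsto_eq_intros) auto
    then have "((\<lambda>y::'k. norm (conjugate y)) \<longlongrightarrow> 0) (at 0)"
      by (simp only: norm_conjugate)
    then have "(conjugate \<longlongrightarrow> (0::'k)) (at 0)"
      by (simp only: tendsto_norm_zero_iff)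
    then show ?thesis
      by (simp add: True isCont_def) (simp add: conjugate_def)
  next
    case False
    then show ?thesis
      unfolding conjugate_def[abs_def] by (intro continuous_intros)
  qed
  then show ?thesis
    by (simp add: continuous_at_imp_continuous_on)
qed

text \<open>The squared modulus of \<open>f\<close> is \<open>f * conjugate f\<close>, and the
  conjugate vanishes wherever \<open>f\<close> does, so it lies in \<open>C_c Y\<close> and the
  ideal absorbs the product. Finite sums follow by induction.\<close>

lemma ideal_sum_of_squares:
  fixes I :: "('a \<Rightarrow> 'k::real_normed_field) set"
  assumes I: "I \<subseteq> C_c Y" and z: "fun_zero Y \<in> I"
    and add: "\<And>f g. f \<in> I \<Longrightarrow> g \<in> I \<Longrightarrow> fun_add Y f g \<in> I"
    and mult: "\<And>f g. f \<in> I \<Longrightarrow> g \<in> C_c Y \<Longrightarrow> fun_mult Y f g \<in> I"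
    and F: "finite F" "F \<subseteq> I"
  shows "(\<lambda>x\<in>topspace Y. of_real (\<Sum>f\<in>F. (norm (f x))\<^sup>2)) \<in> I"
  using F
proof (induction F)
  case empty
  then show ?case
    using z by (auto simp: fun_zero_def restrict_def)
next
  case (insert f F)
  define h where "h = (\<lambda>x\<in>topspace Y. conjugate (f x))"
  have fc: "f \<in> C_c Y"
    using insert.prems I by auto
  then have fb: "f \<in> C_b Y" "continuous_map Y euclidean f"
    by (auto simp: C_c_def C_b_iff)
  obtain B where B: "\<And>x. x \<in> topspace Y \<Longrightarrow> norm (f x) \<le> B"
    using C_b_norm_bound[OF fb(1)] by metis
  have "h \<in> C_b Y"
    unfolding h_def
    by (rule restrict_in_C_b[OF continuous_map_compose_on_UNIV[OF fb(2) continuous_on_conjugate]])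
      (use B in \<open>simp add: norm_conjugate\<close>)
  moreover have "supp Y h \<subseteq> supp Y f"
    by (rule supp_mono) (auto simp: Coz_def h_def conjugate_def)
  ultimately have "h \<in> C_c Y"
    using C_c_antimono[OF fc] by blast
  then have "fun_mult Y f h \<in> I"
    using insert.prems mult by blast
  moreover have "(\<lambda>x\<in>topspace Y. of_real (\<Sum>f\<in>F. (norm (f x))\<^sup>2)) \<in> I"
    using insert.IH insert.prems by blast
  ultimately have "fun_add Y (fun_mult Y f h) (\<lambda>x\<in>topspace Y. of_real (\<Sum>f\<in>F. (norm (f x))\<^sup>2)) \<in> I"
    by (rule add)
  also have "fun_add Y (fun_mult Y f h) (\<lambda>x\<in>topspace Y. of_real (\<Sum>f\<in>F. (norm (f x))\<^sup>2)) =
      (\<lambda>x\<in>topspace Y. of_real (\<Sum>f\<in>insert f F. (norm (f x))\<^sup>2))"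
    using insert.hyps
    by (auto simp: fun_add_def fun_mult_def h_def conjugate_mult fun_eq_iff restrict_def)
  finally show ?case .
qed

text \<open>The cozero sets of members of \<open>I\<close> cover the compact support of a given
  \<open>g\<close>, and finitely many suffice. The sum \<open>r\<close> of the squared moduli of the
  chosen functions, viewed as a scalar function, lies in \<open>I\<close> and is positive on that
  support, so \<open>g\<close> can be divided by \<open>r\<close> there and becomes a multiple of a
  member of \<open>I\<close>.\<close>

lemma ideal_without_common_zero:
  fixes I :: "('a \<Rightarrow> 'k::real_normed_field) set"
  assumes I: "I \<subseteq> C_c Y" and z: "fun_zero Y \<in> I"
    and add: "\<And>f g. f \<in> I \<Longrightarrow> g \<in> I \<Longrightarrow> fun_add Y f g \<in> I"
    and mult: "\<And>f g. f \<in> I \<Longrightarrow> g \<in> C_c Y \<Longrightarrow> fun_mult Y f g \<in> I"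
    and nz: "\<And>y. y \<in> topspace Y \<Longrightarrow> \<exists>f\<in>I. f y \<noteq> 0"
  shows "I = C_c Y"
proof
  show "C_c Y \<subseteq> I"
  proof
    fix g :: "'a \<Rightarrow> 'k" assume g: "g \<in> C_c Y"
    have Ic: "continuous_map Y euclidean f" if "f \<in> I" for f
      using that I by (auto simp: C_c_def C_b_iff)
    have K: "compactin Y (supp Y g)"
      using g by (simp add: C_c_def)
    obtain F where F: "finite F" "F \<subseteq> I" "supp Y g \<subseteq> (\<Union>f\<in>F. Coz Y f)"
    proof -
      have "supp Y g \<subseteq> \<Union>(Coz Y ` I)"
      proof
        fix y assume "y \<in> supp Y g"
        then have "y \<in> topspace Y"
          using compactin_subset_topspace[OF K] by blast
        then show "y \<in> \<Union>(Coz Y ` I)"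
          using nz[of y] by (auto simp: Coz_def)
      qed
      moreover have "openin Y U" if "U \<in> Coz Y ` I" for U
        using that Ic openin_Coz by auto
      ultimately obtain \<F> where \<F>: "finite \<F>" "\<F> \<subseteq> Coz Y ` I" "supp Y g \<subseteq> \<Union>\<F>"
        using compactinD[OF K, of "Coz Y ` I"] by meson
      obtain F where "F \<subseteq> I" "finite F" "\<F> = Coz Y ` F"
        using finite_subset_image[OF \<F>(1,2)] by blast
      then show thesis
        using that[of F] \<F>(3) by simp
    qed
    define r where "r = (\<lambda>x. \<Sum>f\<in>F. (norm (f x))\<^sup>2)"
    have cr: "continuous_map Y euclidean r"
      unfolding r_def using F(2)
      by (intro continuous_map_sum F(1) continuous_map_compose_on_UNIV[OF Ic, where h = "\<lambda>x. (norm x)\<^sup>2"]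
          continuous_intros) auto
    have rpos: "r x > 0" if x: "x \<in> supp Y g" for x
    proof -
      obtain f where "f \<in> F" "f x \<noteq> 0"
        using F(3) x by (auto simp: Coz_def)
      then have "0 < (norm (f x))\<^sup>2" "(norm (f x))\<^sup>2 \<le> r x"
        unfolding r_def using F(1) by (auto intro: member_le_sum)
      then show ?thesis by linarith
    qed
    have "compact (r ` supp Y g)"
      using image_compactin[OF K cr] by simp
    \<comment> \<open>By compactness \<open>r\<close> attains a positive minimum on the support; for
      an empty support any positive constant serves.\<close>
    obtain e where e: "e > 0" "\<And>x. x \<in> supp Y g \<Longrightarrow> e \<le> r x"
    proof (cases "supp Y g = {}")
      case True
      then show thesis using that[of 1] by simp
    next
      case False
      then obtain s where s: "s \<in> r ` supp Y g" "\<And>t. t \<in> r ` supp Y g \<Longrightarrow> s \<le> t"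
        using compact_attains_inf[OF \<open>compact (r ` supp Y g)\<close>] by auto
      then show thesis
        using that[of s] rpos by auto
    qed
    \<comment> \<open>Replacing \<open>r x\<close> by \<open>max (r x) e\<close> keeps the
      reciprocal continuous and bounded on all of \<open>Y\<close>, while on the support of
      \<open>g\<close> nothing changes because \<open>e \<le> r x\<close> there.\<close>
    define q :: "'a \<Rightarrow> 'k" where "q = (\<lambda>x\<in>topspace Y. of_real (inverse (max (r x) e)))"
    have "continuous_map Y euclidean (\<lambda>x. of_real (inverse (max (r x) e)) :: 'k)"
      by (rule continuous_map_compose_on_UNIV[OF cr]) (use e in \<open>auto intro!: continuous_intros\<close>)
    then have "q \<in> C_b Y"
      unfolding q_def
      by (rule restrict_in_C_b[of _ _ "inverse e"]) (use e in \<open>auto simp: norm_inverse abs_if\<close>)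
    then have "fun_mult Y g q \<in> C_c Y"
      using g C_c_mult by blast
    then have "fun_mult Y (\<lambda>x\<in>topspace Y. of_real (r x)) (fun_mult Y g q) \<in> I"
      unfolding r_def by (intro mult ideal_sum_of_squares[OF I z add mult F(1,2)])
    also have "fun_mult Y (\<lambda>x\<in>topspace Y. of_real (r x)) (fun_mult Y g q) = g"
    proof
      fix x
      show "fun_mult Y (\<lambda>x\<in>topspace Y. of_real (r x)) (fun_mult Y g q) x = g x"
      proof (cases "x \<in> Coz Y g")
        case True
        then have x: "x \<in> topspace Y" "e \<le> r x"
          using True e(2) Coz_subset_supp[of Y g] by (auto simp: Coz_def)
        then have "(of_real (r x) :: 'k) * of_real (inverse (max (r x) e)) = 1"
          using e(1) by (simp flip: of_real_mult)
        then show ?thesis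
          using x by (simp add: fun_mult_def q_def mult.left_commute)
      next
        case False
        then show ?thesis
          using g by (auto simp: fun_mult_def Coz_def C_c_def C_b_iff extensional_def)
      qed
    qed
    finally show "g \<in> I" .
  qed
qed (rule I)

text \<open>The kernel \<open>I\<close> of \<xi> is a proper ideal, so by
  \<open>ideal_without_common_zero\<close> all its members vanish at some \<open>y\<close>.
  Subtracting a multiple of a normalized \<open>u\<close> moves any \<open>f\<close> into
  \<open>I\<close>, which ties \<open>f y\<close> to \<open>\<xi> f\<close>.\<close>

lemma character_of_C_c:
  fixes \<xi> :: "('a \<Rightarrow> 'k::real_normed_field) \<Rightarrow> 'k"
  assumes add: "\<And>f g. f \<in> C_c Y \<Longrightarrow> g \<in> C_c Y \<Longrightarrow> \<xi> (fun_add Y f g) = \<xi> f + \<xi> g"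
    and scale: "\<And>c f. f \<in> C_c Y \<Longrightarrow> \<xi> (fun_scale Y c f) = c * \<xi> f"
    and mult: "\<And>f g. f \<in> C_c Y \<Longrightarrow> g \<in> C_c Y \<Longrightarrow> \<xi> (fun_mult Y f g) = \<xi> f * \<xi> g"
    and g: "g \<in> C_c Y" "\<xi> g \<noteq> 0"
    and rich: "\<And>y. y \<in> topspace Y \<Longrightarrow> \<exists>f\<in>C_c Y. (f y :: 'k) \<noteq> 0"
  obtains y where "y \<in> topspace Y" "\<And>f. f \<in> C_c Y \<Longrightarrow> \<xi> f = f y"
proof -
  define I where "I = {f \<in> C_c Y. \<xi> f = 0}"
  \<comment> \<open>Writing zero as a multiple of \<open>g\<close> lets \<open>scale\<close> compute
    its value under \<xi>.\<close>
  have zero: "fun_zero Y = fun_scale Y 0 g"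
    by (auto simp: fun_zero_def fun_scale_def)
  have "I \<noteq> C_c Y"
    using g by (auto simp: I_def)
  moreover have "fun_zero Y \<in> I"
    unfolding zero I_def using g by (simp add: scale C_c_scale)
  moreover have "fun_add Y f h \<in> I" if "f \<in> I" "h \<in> I" for f h
    using that by (simp add: I_def add C_c_add)
  moreover have "fun_mult Y f h \<in> I" if "f \<in> I" "h \<in> C_c Y" for f h
    using that by (simp add: I_def mult C_c_mult C_c_in_C_b)
  moreover have "I \<subseteq> C_c Y"
    by (auto simp: I_def)
  ultimately obtain y where y: "y \<in> topspace Y" "\<And>f. f \<in> I \<Longrightarrow> f y = 0"
    using ideal_without_common_zero[of I Y] by blast
  define u where "u = fun_scale Y (inverse (\<xi> g)) g"
  have u: "u \<in> C_c Y" "\<xi> u = 1"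
    using g by (simp_all add: u_def scale C_c_scale)
  have eq: "f y = \<xi> f * u y" if f: "f \<in> C_c Y" for f
  proof -
    have "fun_add Y f (fun_scale Y (- \<xi> f) u) \<in> I"
      using f u by (simp add: I_def add scale C_c_add C_c_scale)
    from y(2)[OF this] show ?thesis
      using y(1) by (simp add: fun_add_def fun_scale_def)
  qed
  obtain f :: "'a \<Rightarrow> 'k" where "f \<in> C_c Y" "f y \<noteq> 0"
    using rich y(1) by blast
  then have "u y \<noteq> 0"
    using eq by force
  \<comment> \<open>This is \<open>eq\<close> for the square of \<open>u\<close>, since \<xi> is
    multiplicative and \<open>\<xi> u = 1\<close>; a nonzero idempotent of a field is 1.\<close>
  moreover have "u y * u y = u y"
    using eq[of "fun_mult Y u u"] u y(1) by (simp add: C_c_mult C_c_in_C_b mult) (simp add: fun_mult_def)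
  ultimately have "u y = 1"
    by simp
  then show thesis
    using that y(1) eq by simp
qed

section \<open>Isometric isomorphisms\<close>

text \<open>Since \<open>A\<close> is closed under the operations, the expected value of the inverse
  map lies in \<open>A\<close>; it is identified by applying \<phi> and then undoing it.\<close>

lemma isometrically_isomorphic_sym:
  assumes iso: "isometrically_isomorphic X A Y B" and A: "subalgebra_of_C_b X A"
  shows "isometrically_isomorphic Y B X A"
proof -
  obtain \<phi> where \<phi>: "bij_betw \<phi> A B"
    "\<forall>f\<in>A. \<forall>g\<in>A. \<phi> (fun_add X f g) = fun_add Y (\<phi> f) (\<phi> g)"
    "\<forall>c. \<forall>f\<in>A. \<phi> (fun_scale X c f) = fun_scale Y c (\<phi> f)"
    "\<forall>f\<in>A. \<forall>g\<in>A. \<phi> (fun_mult X f g) = fun_mult Y (\<phi> f) (\<phi> g)"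
    "\<forall>f\<in>A. sup_norm Y (\<phi> f) = sup_norm X f"
    using iso unfolding isometrically_isomorphic_def by blast
  let ?\<psi> = "inv_into A \<phi>"
  have \<psi>: "?\<psi> f \<in> A" "\<phi> (?\<psi> f) = f" if "f \<in> B" for f
    using \<phi>(1) that by (auto simp: bij_betw_def inv_into_into f_inv_into_f)
  have \<psi>\<phi>: "?\<psi> (\<phi> f) = f" if "f \<in> A" for f
    using \<phi>(1) that by (simp add: bij_betw_def)
  have "?\<psi> (fun_add Y f g) = fun_add X (?\<psi> f) (?\<psi> g)" if "f \<in> B" "g \<in> B" for f g
    using \<phi>(2) A \<psi>[OF that(1)] \<psi>[OF that(2)] \<psi>\<phi>[of "fun_add X (?\<psi> f) (?\<psi> g)"]
    by (simp add: subalgebra_of_C_b_def)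
  moreover have "?\<psi> (fun_scale Y c f) = fun_scale X c (?\<psi> f)" if "f \<in> B" for c f
    using \<phi>(3) A \<psi>[OF that(1)] \<psi>\<phi>[of "fun_scale X c (?\<psi> f)"]
    by (simp add: subalgebra_of_C_b_def)
  moreover have "?\<psi> (fun_mult Y f g) = fun_mult X (?\<psi> f) (?\<psi> g)" if "f \<in> B" "g \<in> B" for f g
    using \<phi>(4) A \<psi>[OF that(1)] \<psi>[OF that(2)] \<psi>\<phi>[of "fun_mult X (?\<psi> f) (?\<psi> g)"]
    by (simp add: subalgebra_of_C_b_def)
  moreover have "sup_norm X (?\<psi> f) = sup_norm Y f" if "f \<in> B" for f
    using \<phi>(5) \<psi>[OF that] by metis
  ultimately show ?thesis
    unfolding isometrically_isomorphic_def using bij_betw_inv_into[OF \<phi>(1)]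
    by (intro exI[of _ ?\<psi>]) simp
qed

lemma isometrically_isomorphic_trans:
  assumes "isometrically_isomorphic X A Y B" and "isometrically_isomorphic Y B Z C"
  shows "isometrically_isomorphic X A Z C"
proof -
  obtain \<phi> where \<phi>: "bij_betw \<phi> A B"
    "\<forall>f\<in>A. \<forall>g\<in>A. \<phi> (fun_add X f g) = fun_add Y (\<phi> f) (\<phi> g)"
    "\<forall>c. \<forall>f\<in>A. \<phi> (fun_scale X c f) = fun_scale Y c (\<phi> f)"
    "\<forall>f\<in>A. \<forall>g\<in>A. \<phi> (fun_mult X f g) = fun_mult Y (\<phi> f) (\<phi> g)"
    "\<forall>f\<in>A. sup_norm Y (\<phi> f) = sup_norm X f"
    using assms(1) unfolding isometrically_isomorphic_def by blast
  obtain \<psi> where \<psi>: "bij_betw \<psi> B C"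
    "\<forall>f\<in>B. \<forall>g\<in>B. \<psi> (fun_add Y f g) = fun_add Z (\<psi> f) (\<psi> g)"
    "\<forall>c. \<forall>f\<in>B. \<psi> (fun_scale Y c f) = fun_scale Z c (\<psi> f)"
    "\<forall>f\<in>B. \<forall>g\<in>B. \<psi> (fun_mult Y f g) = fun_mult Z (\<psi> f) (\<psi> g)"
    "\<forall>f\<in>B. sup_norm Z (\<psi> f) = sup_norm Y f"
    using assms(2) unfolding isometrically_isomorphic_def by blast
  have "\<phi> f \<in> B" if "f \<in> A" for f
    using \<phi>(1) that by (auto simp: bij_betw_def)
  then show ?thesis
    unfolding isometrically_isomorphic_def using bij_betw_trans[OF \<phi>(1) \<psi>(1)] \<phi>(2-) \<psi>(2-)
    by (intro exI[of _ "\<psi> \<circ> \<phi>"]) simp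
qed

section \<open>Recovering a locally compact space from its functions of compact support\<close>

text \<open>For fixed \<open>y\<close>, sending \<open>f\<close> to \<open>\<psi> f y\<close> is a
  nonzero character of \<open>C_c L\<close>, hence evaluation at a point, which is called
  \<open>\<tau> y\<close>. The direction reverses: a map from \<open>C_c L\<close> to
  \<open>C_c Y\<close> yields a map from \<open>Y\<close> to \<open>L\<close>.\<close>

lemma C_c_isomorphism_induces_map:
  fixes \<psi> :: "('b \<Rightarrow> 'k::real_normed_field) \<Rightarrow> 'a \<Rightarrow> 'k"
  assumes Y: "locally_compact_space Y" "Hausdorff_space Y"
    and L: "locally_compact_space L" "Hausdorff_space L"
    and bij: "bij_betw \<psi> (C_c L) (C_c Y)"
    and add: "\<And>f g. f \<in> C_c L \<Longrightarrow> g \<in> C_c L \<Longrightarrow> \<psi> (fun_add L f g) = fun_add Y (\<psi> f) (\<psi> g)"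
    and scale: "\<And>c f. f \<in> C_c L \<Longrightarrow> \<psi> (fun_scale L c f) = fun_scale Y c (\<psi> f)"
    and mult: "\<And>f g. f \<in> C_c L \<Longrightarrow> g \<in> C_c L \<Longrightarrow> \<psi> (fun_mult L f g) = fun_mult Y (\<psi> f) (\<psi> g)"
  obtains \<tau> where "continuous_map Y L \<tau>"
    "\<And>y f. y \<in> topspace Y \<Longrightarrow> f \<in> C_c L \<Longrightarrow> f (\<tau> y) = \<psi> f y"
proof -
  have "\<exists>l\<in>topspace L. \<forall>f\<in>C_c L. \<psi> f y = f l" if y: "y \<in> topspace Y" for y
  proof -
    \<comment> \<open>The character at \<open>y\<close> is nonzero because surjectivity of \<psi>
      lifts a function with value 1 at \<open>y\<close>.\<close>
    obtain h :: "'a \<Rightarrow> 'k" where h: "h \<in> C_c Y" "h y = 1"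
      using C_c_bump[OF Y openin_topspace y] by metis
    then obtain g where g: "g \<in> C_c L" "\<psi> g = h"
      using bij by (metis bij_betw_imp_surj_on imageE)
    have rich: "\<exists>f\<in>C_c L. f l \<noteq> (0::'k)" if "l \<in> topspace L" for l
      using C_c_bump[OF L openin_topspace that] by (metis zero_neq_one)
    show ?thesis
      by (rule character_of_C_c[of L "\<lambda>f. \<psi> f y" g])
        (use add scale mult y g h rich in \<open>auto simp: fun_add_def fun_scale_def fun_mult_def\<close>)
  qed
  then obtain \<tau> where \<tau>: "\<And>y. y \<in> topspace Y \<Longrightarrow> \<tau> y \<in> topspace L"
    "\<And>y f. y \<in> topspace Y \<Longrightarrow> f \<in> C_c L \<Longrightarrow> \<psi> f y = f (\<tau> y)"
    by metis
  have "continuous_map Y L \<tau>"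
    unfolding continuous_map_def
  proof (intro conjI allI impI)
    show "\<tau> \<in> topspace Y \<rightarrow> topspace L"
      using \<tau>(1) by auto
    fix U assume U: "openin L U"
    show "openin Y {y \<in> topspace Y. \<tau> y \<in> U}"
      unfolding openin_subopen[of _ "{y \<in> topspace Y. \<tau> y \<in> U}"]
    proof clarify
      fix y assume y: "y \<in> topspace Y" "\<tau> y \<in> U"
      \<comment> \<open>On \<open>Y\<close> the function \<open>\<psi> g\<close> is \<open>g\<close>
        composed with \<tau>, so for a bump \<open>g\<close> at \<open>\<tau> y\<close> inside
        \<open>U\<close> its open cozero set contains \<open>y\<close> and is mapped into
        \<open>U\<close>.\<close>
      obtain g :: "'b \<Rightarrow> 'k" where g: "g \<in> C_c L" "g (\<tau> y) = 1" "Coz L g \<subseteq> U"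
        using C_c_bump[OF L U y(2)] by metis
      have "\<psi> g \<in> C_c Y"
        using bij g(1) by (auto simp: bij_betw_def)
      then have "openin Y (Coz Y (\<psi> g))"
        by (auto simp: C_c_def C_b_iff intro: openin_Coz)
      moreover have "y \<in> Coz Y (\<psi> g)" "Coz Y (\<psi> g) \<subseteq> {y \<in> topspace Y. \<tau> y \<in> U}"
        using y g \<tau> by (auto simp: Coz_def)
      ultimately show "\<exists>T. openin Y T \<and> y \<in> T \<and> T \<subseteq> {y \<in> topspace Y. \<tau> y \<in> U}"
        by blast
    qed
  qed
  then show thesis
    using that \<tau>(2) by metis
qed

lemma C_c_separates_points:
  assumes L: "locally_compact_space L" "Hausdorff_space L"
    and "x \<in> topspace L" "y \<in> topspace L"
    and eq: "\<And>f. f \<in> C_c L \<Longrightarrow> f x = (f y :: 'k::real_normed_field)"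
  shows "x = y"
proof (rule ccontr)
  assume "x \<noteq> y"
  then have U: "openin L (topspace L - {y})" "x \<in> topspace L - {y}"
    using assms(2-4) by (auto simp: closedin_Hausdorff_singleton)
  obtain g :: "'a \<Rightarrow> 'k" where "g \<in> C_c L" "g x = 1" "Coz L g \<subseteq> topspace L - {y}"
    using C_c_bump[OF L U] by metis
  then show False
    using eq[of g] assms(4) by (auto simp: Coz_def)
qed

text \<open>The isomorphism and its inverse induce continuous maps \<sigma> and \<tau> between the
  spaces. Each composite leaves the values of all functions of compact support unchanged, so it is
  the identity because such functions separate points.\<close>

theorem C_c_determines_space:
  fixes Y :: "'a topology" and L :: "'b topology"
  assumes Y: "locally_compact_space Y" "Hausdorff_space Y"
    and L: "locally_compact_space L" "Hausdorff_space L"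
    and iso: "isometrically_isomorphic Y (C_c Y :: ('a \<Rightarrow> 'k::real_normed_field) set) L (C_c L)"
  shows "Y homeomorphic_space L"
proof -
  obtain \<phi> where \<phi>: "bij_betw \<phi> (C_c Y) (C_c L :: ('b \<Rightarrow> 'k) set)"
    "\<And>f g. f \<in> C_c Y \<Longrightarrow> g \<in> C_c Y \<Longrightarrow> \<phi> (fun_add Y f g) = fun_add L (\<phi> f) (\<phi> g)"
    "\<And>c f. f \<in> C_c Y \<Longrightarrow> \<phi> (fun_scale Y c f) = fun_scale L c (\<phi> f)"
    "\<And>f g. f \<in> C_c Y \<Longrightarrow> g \<in> C_c Y \<Longrightarrow> \<phi> (fun_mult Y f g) = fun_mult L (\<phi> f) (\<phi> g)"
    using iso unfolding isometrically_isomorphic_def by blast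
  let ?\<psi> = "inv_into (C_c Y) \<phi>"
  have \<psi>: "?\<psi> f \<in> C_c Y" "\<phi> (?\<psi> f) = f" if "f \<in> C_c L" for f
    using \<phi>(1) that by (auto simp: bij_betw_def inv_into_into f_inv_into_f)
  have \<psi>\<phi>: "\<phi> f \<in> C_c L" "?\<psi> (\<phi> f) = f" if "f \<in> C_c Y" for f
    using \<phi>(1) that by (auto simp: bij_betw_def)
  obtain \<sigma> where \<sigma>: "continuous_map L Y \<sigma>"
    "\<And>l f. l \<in> topspace L \<Longrightarrow> f \<in> C_c Y \<Longrightarrow> f (\<sigma> l) = \<phi> f l"
    using C_c_isomorphism_induces_map[OF L Y \<phi>] by metis
  have bij': "bij_betw ?\<psi> (C_c L) (C_c Y)"
    by (rule bij_betw_inv_into[OF \<phi>(1)])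
  have hom: "?\<psi> (fun_add L f g) = fun_add Y (?\<psi> f) (?\<psi> g)"
      "?\<psi> (fun_mult L f g) = fun_mult Y (?\<psi> f) (?\<psi> g)" if "f \<in> C_c L" "g \<in> C_c L" for f g
    using \<psi>\<phi>(2)[of "fun_add Y (?\<psi> f) (?\<psi> g)"] \<psi>\<phi>(2)[of "fun_mult Y (?\<psi> f) (?\<psi> g)"]
      \<psi>[OF that(1)] \<psi>[OF that(2)] by (simp_all add: \<phi> C_c_add C_c_mult C_c_in_C_b)
  have homs: "?\<psi> (fun_scale L c f) = fun_scale Y c (?\<psi> f)" if "f \<in> C_c L" for c f
    using \<psi>\<phi>(2)[of "fun_scale Y c (?\<psi> f)"] \<psi>[OF that] by (simp add: \<phi> C_c_scale)
  obtain \<tau> where \<tau>: "continuous_map Y L \<tau>"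
    "\<And>y f. y \<in> topspace Y \<Longrightarrow> f \<in> C_c L \<Longrightarrow> f (\<tau> y) = ?\<psi> f y"
    using C_c_isomorphism_induces_map[OF Y L bij' hom(1) homs hom(2)] by metis
  have \<tau>T: "\<tau> y \<in> topspace L" if "y \<in> topspace Y" for y
    using \<tau>(1) that by (auto simp: continuous_map_def)
  have \<sigma>T: "\<sigma> l \<in> topspace Y" if "l \<in> topspace L" for l
    using \<sigma>(1) that by (auto simp: continuous_map_def)
  have "\<sigma> (\<tau> y) = y" if y: "y \<in> topspace Y" for y
  proof (rule C_c_separates_points[where 'k='k, OF Y])
    show "f (\<sigma> (\<tau> y)) = f y" if "f \<in> C_c Y" for f :: "'a \<Rightarrow> 'k"
      using \<sigma>(2)[OF \<tau>T[OF y] that] \<tau>(2)[OF y \<psi>\<phi>(1)[OF that]] \<psi>\<phi>(2)[OF that] by simp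
  qed (use y \<tau>T \<sigma>T in auto)
  moreover have "\<tau> (\<sigma> l) = l" if l: "l \<in> topspace L" for l
  proof (rule C_c_separates_points[where 'k='k, OF L])
    show "f (\<tau> (\<sigma> l)) = f l" if "f \<in> C_c L" for f :: "'b \<Rightarrow> 'k"
      using \<tau>(2)[OF \<sigma>T[OF l] that] \<sigma>(2)[OF l \<psi>(1)[OF that]] \<psi>(2)[OF that] by simp
  qed (use l \<tau>T \<sigma>T in auto)
  ultimately show ?thesis
    unfolding homeomorphic_space_def homeomorphic_maps_def using \<tau>(1) \<sigma>(1) by blast
qed

section \<open>The algebra \<open>C_P P X\<close>\<close>

text \<open>\<open>P\<close> passes to \<open>M\<close> through the subspace \<open>N\<close>, in
  which \<open>M\<close> is closed. Non-emptiness is demanded because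
  \<open>closed_hereditary\<close> says nothing about the empty subspace.\<close>

lemma closed_hereditary_subtopology:
  assumes "closed_hereditary P" "P (subtopology X N)" "closedin X M" "M \<subseteq> N" "M \<noteq> {}"
  shows "P (subtopology X M)"
proof -
  have "P (subtopology (subtopology X N) M)"
    using assms closedin_subset_topspace[OF assms(3,4)] unfolding closed_hereditary_def by blast
  then show ?thesis
    using assms(4) by (simp add: subtopology_subtopology inf_absorb2)
qed

lemma finite_closed_Union_P:
  assumes P: "preserved_under_finite_closed_sums P"
    and \<C>: "finite \<C>" "\<C> \<noteq> {}" "\<And>C. C \<in> \<C> \<Longrightarrow> closedin X C \<and> C \<noteq> {} \<and> P (subtopology X C)"
  shows "P (subtopology X (\<Union>\<C>))"
proof -
  have sub: "\<Union>\<C> \<subseteq> topspace X"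
    using \<C>(3) closedin_subset by blast
  then have ts: "topspace (subtopology X (\<Union>\<C>)) = \<Union>\<C>"
    by (simp add: inf_absorb2)
  have "\<Union>\<C> \<noteq> {}"
    using \<C> by blast
  moreover have "closedin (subtopology X (\<Union>\<C>)) C \<and> C \<noteq> {} \<and> P (subtopology (subtopology X (\<Union>\<C>)) C)"
    if C: "C \<in> \<C>" for C
  proof -
    have "C \<subseteq> \<Union>\<C>"
      using C by blast
    then show ?thesis
      using \<C>(3)[OF C] by (simp add: closedin_subset_topspace subtopology_subtopology inf_absorb2)
  qed
  ultimately show ?thesis
    using P[unfolded preserved_under_finite_closed_sums_def, rule_format,
        of "subtopology X (\<Union>\<C>)" \<C>] \<C>(1) ts by simp
qed

locale normal_locally_P =
  fixes P :: "'a topology \<Rightarrow> bool" and X :: "'a topology"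
  assumes hereditary: "closed_hereditary P"
    and closed_sums: "preserved_under_finite_closed_sums P"
    and nonempty: "topspace X \<noteq> {}"
    and normal: "normal_space X" and Hausdorff: "Hausdorff_space X"
    and locally: "locally_P P X"
begin

section \<open>Neighborhoods with \<open>P\<close> in a normal space\<close>

lemma ex_P_neighborhood:
  assumes "x \<in> topspace X"
  obtains N where "P_neighborhood P X {x} N"
  using assms locally unfolding locally_P_def by blast

text \<open>Serves functions with empty support: a \<open>P_neighborhood\<close> is non-empty by
  definition, so the neighborhood of some point is taken.\<close>

lemma ex_P_neighborhood_empty:
  obtains N where "P_neighborhood P X {} N"
proof -
  obtain x where "x \<in> topspace X"
    using nonempty by blast
  then obtain N where "P_neighborhood P X {x} N"
    by (rule ex_P_neighborhood)
  then show thesis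
    using that[of N] by (simp add: P_neighborhood_def)
qed

text \<open>Normality places an open \<open>V\<close> around \<open>S\<close> with closure inside
  the interior of \<open>N\<close>; this closure is closed in \<open>N\<close> and inherits
  \<open>P\<close>. Closedness is what lets neighborhoods be united by closed sums.\<close>

lemma closed_P_neighborhood:
  assumes S: "closedin X S" and N: "P_neighborhood P X S N"
  obtains M where "closedin X M" "P_neighborhood P X S M"
proof (cases "S = {}")
  case True
  \<comment> \<open>For empty \<open>S\<close> the interpolated set could be empty, so a singleton
    inside \<open>N\<close> is used.\<close>
  obtain x where x: "x \<in> N" "x \<in> topspace X"
    using N by (auto simp: P_neighborhood_def)
  then have c: "closedin X {x}"
    by (simp add: Hausdorff closedin_Hausdorff_singleton)
  then have "P (subtopology X {x})"
    using closed_hereditary_subtopology[OF hereditary, of X N "{x}"] N x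
    by (simp add: P_neighborhood_def)
  then show thesis
    using that[of "{x}"] c True x by (simp add: P_neighborhood_def)
next
  case False
  obtain V where V: "openin X V" "S \<subseteq> V" "X closure_of V \<subseteq> X interior_of N"
    using normal N S unfolding normal_space_alt P_neighborhood_def
    by (metis openin_interior_of)
  have V': "V \<subseteq> X closure_of V"
    using V(1) by (simp add: closure_of_subset openin_subset)
  have "P (subtopology X (X closure_of V))"
  proof (rule closed_hereditary_subtopology[OF hereditary])
    show "P (subtopology X N)"
      using N by (simp add: P_neighborhood_def)
    show "X closure_of V \<subseteq> N"
      using V(3) interior_of_subset[of X N] by blast
    show "X closure_of V \<noteq> {}"
      using False subset_trans[OF V(2) V'] by auto
  qed simp
  moreover have "S \<subseteq> X interior_of (X closure_of V)"
    using interior_of_maximal[OF V' V(1)] V(2) by blast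
  ultimately show thesis
    using that[of "X closure_of V"] False V(2) V'
    by (auto simp: P_neighborhood_def closure_of_subset_topspace)
qed

text \<open>The neighborhoods are first shrunk to closed ones, because preservation under sums is
  available for closed sets.\<close>

lemma P_neighborhood_Un:
  assumes S: "closedin X S" "closedin X T"
    and N: "P_neighborhood P X S N" "P_neighborhood P X T N'"
  obtains M where "P_neighborhood P X (S \<union> T) M"
proof -
  obtain M where M: "closedin X M" "P_neighborhood P X S M"
    using closed_P_neighborhood[OF S(1) N(1)] by metis
  obtain M' where M': "closedin X M'" "P_neighborhood P X T M'"
    using closed_P_neighborhood[OF S(2) N(2)] by metis
  have "P (subtopology X (\<Union>{M, M'}))"
    by (rule finite_closed_Union_P[OF closed_sums]) (use M M' in \<open>auto simp: P_neighborhood_def\<close>)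
  moreover have "X interior_of M \<subseteq> X interior_of (M \<union> M')" "X interior_of M' \<subseteq> X interior_of (M \<union> M')"
    by (simp_all add: interior_of_mono)
  ultimately have "P_neighborhood P X (S \<union> T) (M \<union> M')"
    using M(2) M'(2) unfolding P_neighborhood_def by auto
  then show thesis
    by (rule that)
qed

lemma P_neighborhood_mono: "P_neighborhood P X S N \<Longrightarrow> T \<subseteq> S \<Longrightarrow> P_neighborhood P X T N"
  by (auto simp: P_neighborhood_def)

section \<open>Algebraic structure of \<open>C_P P X\<close>\<close>

lemma C_P_antimono:
  assumes "f \<in> C_P P X" "g \<in> C_b X" "supp X g \<subseteq> supp X f"
  shows "g \<in> C_P P X"
  using assms P_neighborhood_mono[OF _ assms(3)] by (auto simp: C_P_def)

lemma fun_zero_in_C_P: "fun_zero X \<in> C_P P X"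
proof -
  obtain N where "P_neighborhood P X {} N"
    by (rule ex_P_neighborhood_empty)
  then show ?thesis
    by (auto simp: C_P_def C_b_zero supp_fun_zero)
qed

text \<open>The support of a sum lies in the union of the supports, where
  \<open>P_neighborhood_Un\<close> applies; products and scalar multiples of \<open>f\<close> have
  no larger support than \<open>f\<close>.\<close>

lemma subalgebra_C_P: "subalgebra_of_C_b X (C_P P X :: ('a \<Rightarrow> 'k::real_normed_field) set)"
  unfolding subalgebra_of_C_b_def
proof (intro conjI ballI allI)
  show "C_P P X \<subseteq> (C_b X :: ('a \<Rightarrow> 'k) set)"
    by (auto simp: C_P_def)
next
  fix f g :: "'a \<Rightarrow> 'k" assume fg: "f \<in> C_P P X" "g \<in> C_P P X"
  obtain M where "P_neighborhood P X (supp X f \<union> supp X g) M"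
    using fg P_neighborhood_Un[OF closedin_supp closedin_supp] unfolding C_P_def by blast
  then have "P_neighborhood P X (supp X (fun_add X f g)) M"
    using supp_fun_add by (rule P_neighborhood_mono)
  then show "fun_add X f g \<in> C_P P X"
    using fg by (auto simp: C_P_def C_b_add)
next
  fix f g :: "'a \<Rightarrow> 'k" assume fg: "f \<in> C_P P X" "g \<in> C_P P X"
  then show "fun_mult X f g \<in> C_P P X"
    by (intro C_P_antimono[OF _ _ supp_fun_mult]) (auto simp: C_P_def C_b_mult)
next
  fix c and f :: "'a \<Rightarrow> 'k" assume "f \<in> C_P P X"
  then show "fun_scale X c f \<in> C_P P X"
    by (intro C_P_antimono[OF _ _ supp_fun_scale]) (auto simp: C_P_def C_b_scale)
qed (rule fun_zero_in_C_P)

text \<open>Urysohn's lemma is applied to \<open>S\<close> and the complement of an interpolated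
  open \<open>V\<close> whose closure lies in the interior of \<open>N\<close>. Thus the whole
  support of \<open>u\<close>, and not only its cozero set, has \<open>N\<close> as a
  neighborhood.\<close>

lemma P_Urysohn:
  assumes S: "closedin X S" and N: "P_neighborhood P X S N"
  obtains u :: "'a \<Rightarrow> real" where "u \<in> C_b X" "\<And>x. x \<in> S \<Longrightarrow> u x = 1"
    "P_neighborhood P X (supp X u) N"
proof -
  obtain V where V: "openin X V" "S \<subseteq> V" "X closure_of V \<subseteq> X interior_of N"
    using normal N S unfolding normal_space_alt P_neighborhood_def
    by (metis openin_interior_of)
  have "closedin X (topspace X - V)" "disjnt (topspace X - V) S"
    using V by (auto simp: disjnt_iff)
  then obtain v :: "'a \<Rightarrow> real" where v: "continuous_map X (top_of_set {0..1}) v"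
      "v ` (topspace X - V) \<subseteq> {0}" "v ` S \<subseteq> {1}"
    using Urysohn_lemma[OF normal _ S, of _ 0 1] by auto
  define u where "u = restrict v (topspace X)"
  have "u \<in> C_b X"
    unfolding u_def using v(1)
    by (intro restrict_in_C_b[of _ _ 1]) (force simp: continuous_map_in_subtopology Pi_iff)+
  moreover have "u x = 1" if "x \<in> S" for x
    using that v(3) closedin_subset[OF S] by (auto simp: u_def)
  moreover have "supp X u \<subseteq> X closure_of V"
    unfolding supp_def by (rule closure_of_mono) (use v(2) in \<open>auto simp: Coz_def u_def\<close>)
  then have "P_neighborhood P X (supp X u) N"
    using N V(3) by (auto simp: P_neighborhood_def)
  ultimately show thesis
    using that by metis
qed

text \<open>The constant 1 is in the algebra as soon as \<open>X\<close> itself has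
  \<open>P\<close>. Conversely, at every point some member takes the value 1, so a unit vanishes
  nowhere, its support is \<open>X\<close>, and a \<open>P\<close>-neighborhood of that support can
  only be \<open>X\<close>.\<close>

lemma unital_C_P_iff: "unital X (C_P P X :: ('a \<Rightarrow> 'k::real_normed_field) set) \<longleftrightarrow> P X"
proof
  assume "P X"
  define u :: "'a \<Rightarrow> 'k" where "u = (\<lambda>x\<in>topspace X. 1)"
  have "u \<in> C_b X"
    unfolding u_def by (rule restrict_in_C_b[of _ _ 1]) auto
  moreover have "P_neighborhood P X (supp X u) (topspace X)"
    using \<open>P X\<close> nonempty closedin_subset[OF closedin_supp[of X u]] by (simp add: P_neighborhood_def)
  ultimately have u: "u \<in> C_P P X"
    by (auto simp: C_P_def)
  have "fun_mult X u f = f \<and> fun_mult X f u = f" if "f \<in> C_P P X" for f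
    using that by (auto simp: C_P_def C_b_iff fun_mult_def u_def extensional_def fun_eq_iff)
  then show "unital X (C_P P X :: ('a \<Rightarrow> 'k) set)"
    using u unfolding unital_def by blast
next
  assume "unital X (C_P P X :: ('a \<Rightarrow> 'k) set)"
  then obtain u :: "'a \<Rightarrow> 'k" where u: "u \<in> C_P P X" "\<And>f. f \<in> C_P P X \<Longrightarrow> fun_mult X u f = f"
    unfolding unital_def by blast
  have "x \<in> Coz X u" if x: "x \<in> topspace X" for x
  proof -
    obtain N where N: "P_neighborhood P X {x} N"
      using ex_P_neighborhood[OF x] .
    obtain v :: "'a \<Rightarrow> real" where v: "v \<in> C_b X" "v x = 1" "P_neighborhood P X (supp X v) N"
      using P_Urysohn[OF closedin_Hausdorff_singleton[OF Hausdorff x] N] by auto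
    define f :: "'a \<Rightarrow> 'k" where "f = (\<lambda>x\<in>topspace X. of_real (v x))"
    have "f \<in> C_P P X"
      using v of_real_in_C_b[OF v(1)] unfolding f_def by (auto simp: C_P_def supp_def Coz_of_real)
    then have "u x * f x = f x"
      using u(2)[of f] x by (metis fun_mult_def restrict_apply')
    then show ?thesis
      using x v(2) by (auto simp: f_def Coz_def)
  qed
  then have "topspace X \<subseteq> supp X u"
    using Coz_subset_supp[of X u] by auto
  obtain N where N: "P_neighborhood P X (supp X u) N"
    using u(1) by (auto simp: C_P_def)
  then have "supp X u \<subseteq> N" "N \<subseteq> topspace X" "P (subtopology X N)"
    using interior_of_subset[of X N] by (auto simp: P_neighborhood_def)
  with \<open>topspace X \<subseteq> supp X u\<close> have "N = topspace X"
    by blast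
  then show "P X"
    using \<open>P (subtopology X N)\<close> by simp
qed

end

section \<open>The space \<open>lambda_P\<close>\<close>

text \<open>Both \<open>real\<close> and \<open>complex\<close> are Euclidean spaces, so the
  extension of real functions is applied to each coordinate \<open>f x \<bullet> b\<close> and the
  results are reassembled along \<open>Basis\<close>.\<close>

lemma stone_cech_field_extension:
  fixes f :: "'a \<Rightarrow> 'k::{real_normed_field,euclidean_space}"
  assumes f: "f \<in> C_b X"
  obtains g where "continuous_map (stone_cech X) euclidean g"
    "\<And>x. x \<in> topspace X \<Longrightarrow> g (beta_embed X x) = f x"
proof -
  have "\<exists>g. continuous_map (stone_cech X) euclidean g \<and>
      (\<forall>x\<in>topspace X. g (beta_embed X x) = f x \<bullet> b)" if b: "b \<in> Basis" for b
  proof -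
    obtain B where B: "\<And>x. x \<in> topspace X \<Longrightarrow> norm (f x) \<le> B"
      using C_b_norm_bound[OF f] by metis
    have "norm (f x \<bullet> b) \<le> B" if "x \<in> topspace X" for x
      using B[OF that] Basis_le_norm[OF b, of "f x"] by simp
    moreover have "continuous_map X euclidean (\<lambda>x. f x \<bullet> b)"
      using f by (intro continuous_map_compose_on_UNIV[where h = "\<lambda>z. z \<bullet> b"])
        (auto simp: C_b_iff intro!: continuous_intros)
    ultimately have "(\<lambda>x\<in>topspace X. f x \<bullet> b) \<in> C_b X"
      by (intro restrict_in_C_b)
    then obtain g where "continuous_map (stone_cech X) euclidean g"
      "\<And>x. x \<in> topspace X \<Longrightarrow> g (beta_embed X x) = (\<lambda>x\<in>topspace X. f x \<bullet> b) x"
      using stone_cech_extension by blast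
    then show ?thesis
      by (intro exI[of _ g]) auto
  qed
  then obtain g where g: "\<And>b. b \<in> Basis \<Longrightarrow> continuous_map (stone_cech X) euclidean (g b)"
    "\<And>b x. b \<in> Basis \<Longrightarrow> x \<in> topspace X \<Longrightarrow> g b (beta_embed X x) = f x \<bullet> b"
    by metis
  show thesis
  proof (rule that[of "\<lambda>z. \<Sum>b\<in>Basis. g b z *\<^sub>R b"])
    show "continuous_map (stone_cech X) euclidean (\<lambda>z. \<Sum>b\<in>Basis. g b z *\<^sub>R b)"
    proof (rule continuous_map_sum)
      show "continuous_map (stone_cech X) euclidean (\<lambda>z. g b z *\<^sub>R b)" if "b \<in> Basis" for b
        by (rule continuous_map_compose_on_UNIV[OF g(1)[OF that]]) (intro continuous_intros)
    qed simp
    show "(\<Sum>b\<in>Basis. g b (beta_embed X x) *\<^sub>R b) = f x" if "x \<in> topspace X" for x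
      using that by (simp add: g(2) euclidean_representation cong: sum.cong)
  qed
qed

text \<open>\<open>X\<close> is dense in \<beta>X, so the open cozero set of \<open>g\<close> lies
  in the closure of its trace on \<open>X\<close>, and that trace is the image of
  \<open>Coz X f\<close>. Being open, it even lies in the interior of that closure, the kind of set
  from which \<open>lambda_P\<close> is built.\<close>

lemma Coz_extension_subset:
  assumes g: "continuous_map (stone_cech X) euclidean g"
    and gf: "\<And>x. x \<in> topspace X \<Longrightarrow> g (beta_embed X x) = f x"
  shows "Coz (stone_cech X) g \<subseteq> stone_cech X closure_of (beta_embed X ` Coz X f)"
proof -
  let ?U = "Coz (stone_cech X) g"
  have "?U \<subseteq> ?U \<inter> stone_cech X closure_of (beta_embed X ` topspace X)"
    using beta_embed_dense[of X] by (auto simp: Coz_def)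
  also have "\<dots> \<subseteq> stone_cech X closure_of (?U \<inter> beta_embed X ` topspace X)"
    by (rule openin_Int_closure_of_subset[OF openin_Coz[OF g]])
  also have "\<dots> \<subseteq> stone_cech X closure_of (beta_embed X ` Coz X f)"
    by (rule closure_of_mono) (use gf in \<open>auto simp: Coz_def\<close>)
  finally show ?thesis .
qed

text \<open>As a homeomorphism onto its image, \<open>beta_embed X\<close> preserves closures within
  the image, and closure in the image is the trace of closure in \<beta>X.\<close>

lemma beta_embed_in_closure_iff:
  assumes X: "completely_regular_space X" "Hausdorff_space X"
    and x: "x \<in> topspace X" and C: "C \<subseteq> topspace X"
  shows "beta_embed X x \<in> stone_cech X closure_of (beta_embed X ` C) \<longleftrightarrow> x \<in> X closure_of C"
proof -
  let ?e = "beta_embed X" and ?D = "subtopology (stone_cech X) (beta_embed X ` topspace X)"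
  have h: "homeomorphic_map X ?D ?e"
    using embedding_map_beta_embed[OF X] by (simp add: embedding_map_def)
  have "?e x \<in> stone_cech X closure_of (?e ` C) \<longleftrightarrow> ?e x \<in> ?D closure_of (?e ` C)"
    unfolding closure_of_subtopology using x Int_absorb1[OF image_mono[OF C, of ?e]] by simp
  also have "?D closure_of (?e ` C) = ?e ` (X closure_of C)"
    by (rule homeomorphic_map_closure_of[OF h C])
  also have "?e x \<in> ?e ` (X closure_of C) \<longleftrightarrow> x \<in> X closure_of C"
    using homeomorphic_imp_injective_map[OF h] x closure_of_subset_topspace[of X C]
    by (auto simp: inj_on_def)
  finally show ?thesis .
qed

context normal_locally_P
begin

section \<open>Topology of \<open>lambda_P\<close>\<close>

lemma completely_regular: "completely_regular_space X"
  by (rule normal_imp_completely_regular_space_A[OF normal Hausdorff_imp_t1_space[OF Hausdorff]])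

lemma continuous_map_beta_embed: "continuous_map X (stone_cech X) (beta_embed X)"
  using homeomorphic_imp_continuous_map
    [OF embedding_map_beta_embed[OF completely_regular Hausdorff, unfolded embedding_map_def]]
  by (simp add: continuous_map_in_subtopology)

text \<open>A union of interiors is open in \<beta>X, hence contained in its carrier, so passing to
  the subspace cuts nothing away. Openness later yields local compactness.\<close>

lemma topspace_lambda_P:
  "topspace (lambda_P \<kappa> P X) =
     (\<Union>C\<in>{C. C \<in> cozero_sets \<kappa> X \<and> P (subtopology X (X closure_of C))}.
        stone_cech X interior_of (stone_cech X closure_of (beta_embed X ` C)))" (is "_ = \<Union>?\<U>")
  and openin_topspace_lambda_P: "openin (stone_cech X) (topspace (lambda_P \<kappa> P X))"
proof -
  have U: "openin (stone_cech X) (\<Union>?\<U>)"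
    by (rule openin_Union) auto
  show "topspace (lambda_P \<kappa> P X) = \<Union>?\<U>"
    unfolding lambda_P_def setcompr_eq_image
    using openin_subset[OF U] by (simp only: topspace_subtopology inf_absorb2)
  then show "openin (stone_cech X) (topspace (lambda_P \<kappa> P X))"
    using U by simp
qed

lemma lambda_P_eq_subtopology:
  "lambda_P \<kappa> P X = subtopology (stone_cech X) (topspace (lambda_P \<kappa> P X))"
  unfolding lambda_P_def by (simp only: topspace_subtopology subtopology_restrict)

lemma topspace_lambda_P_subset: "topspace (lambda_P \<kappa> P X) \<subseteq> topspace (stone_cech X)"
  using openin_topspace_lambda_P by (rule openin_subset)

lemma in_lambda_P_iff:
  "z \<in> topspace (lambda_P \<kappa> P X) \<longleftrightarrow>
     (\<exists>C. C \<in> cozero_sets \<kappa> X \<and> P (subtopology X (X closure_of C)) \<and>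
        z \<in> stone_cech X interior_of (stone_cech X closure_of (beta_embed X ` C)))"
  by (simp add: topspace_lambda_P conj_assoc)

lemma Hausdorff_lambda_P: "Hausdorff_space (lambda_P \<kappa> P X)"
  by (simp add: lambda_P_def Hausdorff_space_subtopology Hausdorff_space_stone_cech)

lemma locally_compact_lambda_P: "locally_compact_space (lambda_P \<kappa> P X)"
  by (subst lambda_P_eq_subtopology)
    (simp add: locally_compact_space_open_subset openin_topspace_lambda_P Hausdorff_space_stone_cech
      compact_imp_locally_compact_space compact_space_stone_cech)

text \<open>The extension \<open>g\<close> of a Urysohn function \<open>u\<close> equals 1 on the
  closure of \<open>S\<close> in \<beta>X by continuity, so that closure lies in the cozero set of
  \<open>g\<close> and hence in the interior of the closure of \<open>Coz X u\<close>. The closure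
  of \<open>Coz X u\<close> in \<open>X\<close> is contained in \<open>N\<close> and inherits
  \<open>P\<close>.\<close>

lemma closure_subset_lambda_P:
  assumes S: "closedin X S" and N: "P_neighborhood P X S N"
  shows "stone_cech X closure_of (beta_embed X ` S) \<subseteq> topspace (lambda_P TYPE('k::real_normed_field) P X)"
proof (cases "S = {}")
  case False
  obtain u :: "'a \<Rightarrow> real" where u: "u \<in> C_b X" "\<And>x. x \<in> S \<Longrightarrow> u x = 1"
    "P_neighborhood P X (supp X u) N"
    using P_Urysohn[OF S N] by metis
  have SX: "S \<subseteq> topspace X"
    using S by (rule closedin_subset)
  obtain g where g: "continuous_map (stone_cech X) euclidean g"
    "\<And>x. x \<in> topspace X \<Longrightarrow> g (beta_embed X x) = u x"
    using stone_cech_extension[OF u(1)] by metis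
  have "stone_cech X closure_of (beta_embed X ` S) \<subseteq> {z \<in> topspace (stone_cech X). g z \<in> {1}}"
  proof (rule closure_of_minimal)
    show "closedin (stone_cech X) {z \<in> topspace (stone_cech X). g z \<in> {1}}"
      by (rule closedin_continuous_map_preimage[OF g(1)]) auto
    show "beta_embed X ` S \<subseteq> {z \<in> topspace (stone_cech X). g z \<in> {1}}"
      using SX beta_embed_image_subset[of X] g(2) u(2) by (auto simp: subset_iff)
  qed
  also have "\<dots> \<subseteq> Coz (stone_cech X) g"
    by (auto simp: Coz_def)
  also have "\<dots> \<subseteq> stone_cech X interior_of (stone_cech X closure_of (beta_embed X ` Coz X u))"
    by (rule interior_of_maximal[OF Coz_extension_subset[OF g] openin_Coz[OF g(1)]])
  finally have sub: "stone_cech X closure_of (beta_embed X ` S)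
    \<subseteq> stone_cech X interior_of (stone_cech X closure_of (beta_embed X ` Coz X u))" .
  have "Coz X u \<in> cozero_sets TYPE('k) X"
    unfolding cozero_sets_def using of_real_in_C_b[OF u(1)] Coz_of_real by (metis image_eqI)
  moreover have "P (subtopology X (X closure_of Coz X u))"
  proof (rule closed_hereditary_subtopology[OF hereditary])
    show "P (subtopology X N)"
      using N by (simp add: P_neighborhood_def)
    show "X closure_of Coz X u \<subseteq> N"
      using u(3) interior_of_subset[of X N] unfolding P_neighborhood_def supp_def by blast
    show "X closure_of Coz X u \<noteq> {}"
    proof -
      obtain x where "x \<in> S"
        using False by blast
      then have "x \<in> Coz X u"
        using SX u(2) by (auto simp: Coz_def)
      then show ?thesis
        using Coz_subset_supp[of X u] unfolding supp_def by blast
    qed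
  qed simp
  ultimately have "stone_cech X interior_of (stone_cech X closure_of (beta_embed X ` Coz X u))
      \<subseteq> topspace (lambda_P TYPE('k) P X)"
    unfolding topspace_lambda_P by (intro UN_upper CollectI conjI)
  then show ?thesis
    using sub by (rule subset_trans[rotated])
qed simp

text \<open>Since \<open>X\<close> is locally-\<open>P\<close> and Hausdorff, each singleton is a
  closed set with a \<open>P\<close>-neighborhood, to which \<open>closure_subset_lambda_P\<close>
  applies.\<close>

lemma beta_embed_image_subset_lambda_P:
  "beta_embed X ` topspace X \<subseteq> topspace (lambda_P TYPE('k::real_normed_field) P X)"
proof clarify
  fix x assume x: "x \<in> topspace X"
  obtain N where N: "P_neighborhood P X {x} N"
    using ex_P_neighborhood[OF x] .
  have "beta_embed X x \<in> stone_cech X closure_of (beta_embed X ` {x})"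
    using closure_of_subset[of "beta_embed X ` {x}" "stone_cech X"] beta_embed_image_subset[of X] x
    by auto
  then show "beta_embed X x \<in> topspace (lambda_P TYPE('k) P X)"
    using closure_subset_lambda_P[OF closedin_Hausdorff_singleton[OF Hausdorff x] N] by blast
qed

lemma beta_embed_dense_in_lambda_P:
  "lambda_P TYPE('k::real_normed_field) P X closure_of (beta_embed X ` topspace X) =
     topspace (lambda_P TYPE('k) P X)"
proof -
  let ?S = "topspace (lambda_P TYPE('k) P X)" and ?D = "beta_embed X ` topspace X"
  have "subtopology (stone_cech X) ?S closure_of ?D = ?S \<inter> stone_cech X closure_of (?S \<inter> ?D)"
    by (rule closure_of_subtopology)
  also have "?S \<inter> ?D = ?D"
    using beta_embed_image_subset_lambda_P by (rule Int_absorb1)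
  also have "?S \<inter> stone_cech X closure_of ?D = ?S"
    unfolding beta_embed_dense using topspace_lambda_P_subset by (rule Int_absorb2)
  finally show ?thesis
    unfolding lambda_P_eq_subtopology[symmetric] .
qed

lemma continuous_map_beta_embed_lambda_P:
  "continuous_map X (lambda_P TYPE('k::real_normed_field) P X) (beta_embed X)"
proof -
  let ?S = "topspace (lambda_P TYPE('k) P X)"
  have "continuous_map X (subtopology (stone_cech X) ?S) (beta_embed X)"
    unfolding continuous_map_in_subtopology
    using beta_embed_image_subset_lambda_P continuous_map_beta_embed by blast
  then show ?thesis
    unfolding lambda_P_eq_subtopology[symmetric] .
qed

section \<open>Compact subsets of \<open>lambda_P\<close>\<close>

lemma compactin_lambda_P:
  "compactin (lambda_P \<kappa> P X) K \<longleftrightarrow> compactin (stone_cech X) K \<and> K \<subseteq> topspace (lambda_P \<kappa> P X)"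
  using compactin_subtopology[of "stone_cech X" "topspace (lambda_P \<kappa> P X)" K]
  unfolding lambda_P_eq_subtopology[symmetric] .

text \<open>Compactness thins the defining open cover to a finite one. Members are kept non-empty so
  that closed sums apply to their closures in \<open>X\<close>; an empty \<open>C\<close> would
  contribute nothing to the cover.\<close>

lemma compactin_lambda_P_cover:
  assumes K: "compactin (lambda_P \<kappa> P X) K"
  obtains \<C> where "finite \<C>" "\<And>C. C \<in> \<C> \<Longrightarrow> C \<noteq> {} \<and> C \<subseteq> topspace X \<and> P (subtopology X (X closure_of C))"
    "K \<subseteq> (\<Union>C\<in>\<C>. stone_cech X interior_of (stone_cech X closure_of (beta_embed X ` C)))"
proof -
  let ?i = "\<lambda>C. stone_cech X interior_of (stone_cech X closure_of (beta_embed X ` C))"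
  let ?\<D> = "{C. C \<noteq> {} \<and> C \<subseteq> topspace X \<and> P (subtopology X (X closure_of C))}"
  have K': "compactin (stone_cech X) K" "K \<subseteq> topspace (lambda_P \<kappa> P X)"
    using K by (simp_all add: compactin_lambda_P)
  have "K \<subseteq> \<Union>(?i ` ?\<D>)"
  proof
    fix z assume "z \<in> K"
    then obtain C where C: "C \<in> cozero_sets \<kappa> X" "P (subtopology X (X closure_of C))" "z \<in> ?i C"
      using K'(2) in_lambda_P_iff by blast
    moreover have "C \<noteq> {}"
      using C(3) by auto
    moreover have "C \<subseteq> topspace X"
      using C(1) by (auto simp: cozero_sets_def Coz_def)
    ultimately show "z \<in> \<Union>(?i ` ?\<D>)"
      by blast
  qed
  moreover have "openin (stone_cech X) U" if "U \<in> ?i ` ?\<D>" for U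
    using that by auto
  ultimately obtain \<F> where \<F>: "finite \<F>" "\<F> \<subseteq> ?i ` ?\<D>" "K \<subseteq> \<Union>\<F>"
    using compactinD[OF K'(1), of "?i ` ?\<D>"] by meson
  obtain \<C> where "\<C> \<subseteq> ?\<D>" "finite \<C>" "\<F> = ?i ` \<C>"
    using finite_subset_image[OF \<F>(1,2)] by blast
  then show thesis
    using that[of \<C>] \<F>(3) by auto
qed

section \<open>Restriction from \<open>lambda_P\<close> to \<open>X\<close>\<close>

text \<open>The support of the restriction lies in the preimage of the compact support of
  \<open>h\<close>, which is covered by finitely many of the open sets defining
  \<open>lambda_P\<close>. The union of the corresponding closures in \<open>X\<close> is the
  required neighborhood.\<close>

lemma pullback_in_C_P:
  fixes h :: "(('a \<Rightarrow> real) \<Rightarrow> real) \<Rightarrow> 'k::real_normed_field"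
  assumes h: "h \<in> C_c (lambda_P TYPE('k) P X)"
  shows "(\<lambda>x\<in>topspace X. h (beta_embed X x)) \<in> C_P P X"
proof -
  let ?L = "lambda_P TYPE('k) P X"
  let ?f = "\<lambda>x\<in>topspace X. h (beta_embed X x)"
  let ?K = "supp ?L h"
  have hL: "h \<in> C_b ?L" "compactin ?L ?K"
    using h by (auto simp: C_c_def)
  have e: "beta_embed X x \<in> topspace ?L" if "x \<in> topspace X" for x
    using that beta_embed_image_subset_lambda_P by auto
  obtain B where B: "\<And>z. z \<in> topspace ?L \<Longrightarrow> norm (h z) \<le> B"
    using C_b_norm_bound[OF hL(1)] by metis
  have "continuous_map X euclidean (\<lambda>x. h (beta_embed X x))"
    using continuous_map_compose[OF continuous_map_beta_embed_lambda_P[where 'k='k], of euclidean h] hL(1)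
    by (simp add: C_b_iff o_def)
  then have fb: "?f \<in> C_b X"
    by (rule restrict_in_C_b) (rule B[OF e])
  have supp: "supp X ?f \<subseteq> {x \<in> topspace X. beta_embed X x \<in> ?K}"
  proof (rule supp_subset_closedin)
    show "closedin X {x \<in> topspace X. beta_embed X x \<in> ?K}"
      by (rule closedin_continuous_map_preimage[OF continuous_map_beta_embed_lambda_P closedin_supp])
    show "Coz X ?f \<subseteq> {x \<in> topspace X. beta_embed X x \<in> ?K}"
      using Coz_subset_supp[of ?L h] e by (auto simp: Coz_def)
  qed
  obtain \<C> where \<C>: "finite \<C>"
    "\<And>C. C \<in> \<C> \<Longrightarrow> C \<noteq> {} \<and> C \<subseteq> topspace X \<and> P (subtopology X (X closure_of C))"
    "?K \<subseteq> (\<Union>C\<in>\<C>. stone_cech X interior_of (stone_cech X closure_of (beta_embed X ` C)))"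
    (is "_ \<subseteq> ?W")
    using compactin_lambda_P_cover[OF hL(2)] by metis
  obtain N where "P_neighborhood P X (supp X ?f) N"
  proof (cases "\<C> = {}")
    \<comment> \<open>With no covering sets the closed sum would be empty, so the neighborhood of
      the empty set is used.\<close>
    case True
    then have "supp X ?f = {}"
      using supp \<C>(3) by auto
    then show thesis
      using that ex_P_neighborhood_empty by metis
  next
    case False
    define M where "M = \<Union>((\<lambda>C. X closure_of C) ` \<C>)"
    have ne: "X closure_of C \<noteq> {}" if "C \<in> \<C>" for C
      using \<C>(2)[OF that] closure_of_subset[of C X] by blast
    have "P (subtopology X M)"
      unfolding M_def
      by (rule finite_closed_Union_P[OF closed_sums]) (use \<C>(1,2) False ne in auto)
    \<comment> \<open>The preimage of the open cover is open in \<open>X\<close>; by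
      \<open>beta_embed_in_closure_iff\<close> each of its points lies in the closure of some
      \<open>C\<close>, hence in \<open>M\<close>.\<close>
    moreover have "{x \<in> topspace X. beta_embed X x \<in> ?W} \<subseteq> X interior_of M"
    proof (rule interior_of_maximal)
      show "openin X {x \<in> topspace X. beta_embed X x \<in> ?W}"
        by (rule openin_continuous_map_preimage[OF continuous_map_beta_embed]) auto
      show "{x \<in> topspace X. beta_embed X x \<in> ?W} \<subseteq> M"
      proof clarify
        fix x C assume x: "x \<in> topspace X" "C \<in> \<C>"
          "beta_embed X x \<in> stone_cech X interior_of (stone_cech X closure_of (beta_embed X ` C))"
        then have "beta_embed X x \<in> stone_cech X closure_of (beta_embed X ` C)"
          using subsetD[OF interior_of_subset] by metis
        then have "x \<in> X closure_of C"
          using beta_embed_in_closure_iff[OF completely_regular Hausdorff x(1)] \<C>(2)[OF x(2)] by blast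
        then show "x \<in> M"
          using x(2) by (auto simp: M_def)
      qed
    qed
    then have "supp X ?f \<subseteq> X interior_of M"
      using supp \<C>(3) by blast
    moreover have "M \<noteq> {}" "M \<subseteq> topspace X"
      using False ne closure_of_subset_topspace[of X] by (auto simp: M_def)
    ultimately show thesis
      using that[of M] by (simp add: P_neighborhood_def)
  qed
  then show ?thesis
    using fb by (auto simp: C_P_def)
qed

text \<open>The preimage of \<open>f\<close> is its extension to \<beta>X, cut down to
  \<open>lambda_P\<close>. The cozero set of this function lies in the closure of the support of
  \<open>f\<close> in \<beta>X, which is compact and by \<open>closure_subset_lambda_P\<close> stays
  inside \<open>lambda_P\<close>.\<close>

lemma pullback_surj:
  fixes f :: "'a \<Rightarrow> 'k::{real_normed_field,euclidean_space}"
  assumes f: "f \<in> C_P P X"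
  obtains h where "h \<in> C_c (lambda_P TYPE('k) P X)" "f = (\<lambda>x\<in>topspace X. h (beta_embed X x))"
proof -
  let ?L = "lambda_P TYPE('k) P X"
  have fb: "f \<in> C_b X"
    using f by (auto simp: C_P_def)
  obtain N where N: "P_neighborhood P X (supp X f) N"
    using f by (auto simp: C_P_def)
  obtain g where g: "continuous_map (stone_cech X) euclidean g"
    "\<And>x. x \<in> topspace X \<Longrightarrow> g (beta_embed X x) = f x"
    using stone_cech_field_extension[OF fb] by metis
  define h where "h = restrict g (topspace ?L)"
  have "bounded (g ` topspace (stone_cech X))"
    using image_compactin[OF compact_space_stone_cech[unfolded compact_space_def] g(1)]
    by (simp add: compact_imp_bounded)
  then obtain B where B: "\<And>z. z \<in> topspace (stone_cech X) \<Longrightarrow> norm (g z) \<le> B"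
    by (auto simp: bounded_iff)
  have "continuous_map ?L euclidean g"
    unfolding lambda_P_def by (rule continuous_map_from_subtopology[OF g(1)])
  then have hb: "h \<in> C_b ?L"
    unfolding h_def by (rule restrict_in_C_b) (rule B[OF subsetD[OF topspace_lambda_P_subset]])
  let ?K = "stone_cech X closure_of (beta_embed X ` supp X f)"
  have "compactin (stone_cech X) ?K"
    by (simp add: closedin_compact_space compact_space_stone_cech)
  then have K: "compactin ?L ?K"
    using closure_subset_lambda_P[OF closedin_supp N] by (simp add: compactin_lambda_P)
  have "Coz ?L h \<subseteq> Coz (stone_cech X) g"
    using topspace_lambda_P_subset by (auto simp: Coz_def h_def)
  also have "\<dots> \<subseteq> stone_cech X closure_of (beta_embed X ` Coz X f)"
    by (rule Coz_extension_subset[OF g])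
  also have "\<dots> \<subseteq> ?K"
    by (intro closure_of_mono image_mono Coz_subset_supp)
  finally have "supp ?L h \<subseteq> ?K"
    by (intro supp_subset_closedin compactin_imp_closedin[OF Hausdorff_lambda_P K])
  then have "h \<in> C_c ?L"
    using hb closed_compactin[OF K _ closedin_supp] by (simp add: C_c_def)
  moreover have "f = (\<lambda>x\<in>topspace X. h (beta_embed X x))"
  proof
    fix x
    show "f x = (\<lambda>x\<in>topspace X. h (beta_embed X x)) x"
      using fb g(2)[of x] beta_embed_image_subset_lambda_P[where 'k='k]
      by (auto simp: h_def C_b_iff extensional_def)
  qed
  ultimately show thesis
    by (rule that)
qed

text \<open>The image of \<open>X\<close> is dense in \<open>lambda_P\<close>, and continuous
  functions into a Hausdorff space that agree on a dense set are equal.\<close>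

lemma pullback_inj:
  fixes h :: "(('a \<Rightarrow> real) \<Rightarrow> real) \<Rightarrow> 'k::real_normed_field"
  assumes h: "h \<in> C_b (lambda_P TYPE('k) P X)" "h' \<in> C_b (lambda_P TYPE('k) P X)"
    and eq: "(\<lambda>x\<in>topspace X. h (beta_embed X x)) = (\<lambda>x\<in>topspace X. h' (beta_embed X x))"
  shows "h = h'"
proof (rule C_b_eqI[OF h])
  fix z assume "z \<in> topspace (lambda_P TYPE('k) P X)"
  then have "z \<in> lambda_P TYPE('k) P X closure_of (beta_embed X ` topspace X)"
    by (simp add: beta_embed_dense_in_lambda_P)
  then show "h z = h' z"
  proof (rule forall_in_closure_of_eq[where Y = euclidean])
    show "h w = h' w" if "w \<in> beta_embed X ` topspace X" for w
      using that fun_cong[OF eq] by (metis (no_types, lifting) imageE restrict_apply')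
  qed (use h in \<open>auto simp: C_b_iff\<close>)
qed

lemma sup_norm_pullback:
  fixes h :: "(('a \<Rightarrow> real) \<Rightarrow> real) \<Rightarrow> 'k::real_normed_field"
  assumes h: "h \<in> C_b (lambda_P TYPE('k) P X)"
  shows "sup_norm X (\<lambda>x\<in>topspace X. h (beta_embed X x)) = sup_norm (lambda_P TYPE('k) P X) h"
proof -
  let ?L = "lambda_P TYPE('k) P X"
  obtain B where B: "\<And>z. z \<in> topspace ?L \<Longrightarrow> norm (h z) \<le> B"
    using C_b_norm_bound[OF h] by metis
  have e: "beta_embed X x \<in> topspace ?L" if "x \<in> topspace X" for x
    using that beta_embed_image_subset_lambda_P by auto
  have ne: "topspace ?L \<noteq> {}"
    using nonempty e by (metis ex_in_conv)
  have bdX: "bdd_above ((\<lambda>x. norm (h (beta_embed X x))) ` topspace X)"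
    using B e by (auto simp: bdd_above_def)
  have bdL: "bdd_above ((\<lambda>z. norm (h z)) ` topspace ?L)"
    using B by (auto simp: bdd_above_def)
  have "(SUP x\<in>topspace X. norm (h (beta_embed X x))) = (SUP z\<in>topspace ?L. norm (h z))"
  proof (rule antisym)
    show "(SUP x\<in>topspace X. norm (h (beta_embed X x))) \<le> (SUP z\<in>topspace ?L. norm (h z))"
      by (rule cSUP_mono[OF nonempty bdL]) (use e in blast)
    let ?s = "SUP x\<in>topspace X. norm (h (beta_embed X x))"
    \<comment> \<open>For the reverse inequality, the bound by the supremum over \<open>X\<close>
      defines a closed set containing a dense one, hence everything.\<close>
    have C: "closedin ?L {z \<in> topspace ?L. h z \<in> cball 0 ?s}"
      by (rule closedin_continuous_map_preimage[of _ euclidean]) (use h in \<open>auto simp: C_b_iff\<close>)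
    have "beta_embed X ` topspace X \<subseteq> {z \<in> topspace ?L. h z \<in> cball 0 ?s}"
      using e cSUP_upper[OF _ bdX] by auto
    from closure_of_minimal[OF this C]
    have "topspace ?L \<subseteq> {z \<in> topspace ?L. h z \<in> cball 0 ?s}"
      by (simp only: beta_embed_dense_in_lambda_P)
    then show "(SUP z\<in>topspace ?L. norm (h z)) \<le> ?s"
      using cSUP_least[OF ne, of "\<lambda>z. norm (h z)" ?s] by auto
  qed
  moreover have "sup_norm X (\<lambda>x\<in>topspace X. h (beta_embed X x)) =
      (SUP x\<in>topspace X. norm (h (beta_embed X x)))"
    unfolding sup_norm_def by (rule SUP_cong) auto
  ultimately show ?thesis
    by (simp add: sup_norm_def)
qed

text \<open>The isomorphism is built from \<open>lambda_P\<close> towards \<open>X\<close>, where it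
  is plain restriction and so visibly a homomorphism; symmetry then turns it around.\<close>

lemma isometrically_isomorphic_C_P_C_c_lambda_P:
  "isometrically_isomorphic X (C_P P X :: ('a \<Rightarrow> 'k::{real_normed_field,euclidean_space}) set)
     (lambda_P TYPE('k) P X) (C_c (lambda_P TYPE('k) P X))"
proof (rule isometrically_isomorphic_sym[OF _ subalgebra_C_c])
  let ?L = "lambda_P TYPE('k) P X"
  let ?\<rho> = "\<lambda>h::_ \<Rightarrow> 'k. \<lambda>x\<in>topspace X. h (beta_embed X x)"
  have e: "beta_embed X x \<in> topspace ?L" if "x \<in> topspace X" for x
    using that beta_embed_image_subset_lambda_P by auto
  have "bij_betw ?\<rho> (C_c ?L) (C_P P X)"
    unfolding bij_betw_def
  proof
    show "inj_on ?\<rho> (C_c ?L)"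
      by (rule inj_onI) (use pullback_inj C_c_in_C_b in blast)
    show "?\<rho> ` C_c ?L = C_P P X"
      using pullback_in_C_P pullback_surj by blast
  qed
  moreover have "?\<rho> (fun_add ?L f g) = fun_add X (?\<rho> f) (?\<rho> g)" for f g
    using e by (auto simp: fun_add_def fun_eq_iff)
  moreover have "?\<rho> (fun_scale ?L c f) = fun_scale X c (?\<rho> f)" for c f
    using e by (auto simp: fun_scale_def fun_eq_iff)
  moreover have "?\<rho> (fun_mult ?L f g) = fun_mult X (?\<rho> f) (?\<rho> g)" for f g
    using e by (auto simp: fun_mult_def fun_eq_iff)
  ultimately show "isometrically_isomorphic ?L (C_c ?L) X (C_P P X :: ('a \<Rightarrow> 'k) set)"
    unfolding isometrically_isomorphic_def
    by (intro exI[of _ ?\<rho>]) (simp add: sup_norm_pullback C_c_in_C_b)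
qed

text \<open>A generic scalar type lets one proof serve both fields. For uniqueness, an isomorphism
  of the algebra with \<open>C_c Y\<close> is inverted and followed by the one onto
  \<open>C_c\<close> of \<open>lambda_P\<close>, and \<open>C_c_determines_space\<close> applies to
  the composite.\<close>

lemma C_P_representation:
  "(let A = (C_P P X :: ('a \<Rightarrow> 'k::{real_normed_field,euclidean_space}) set);
        L = lambda_P TYPE('k) P X in
      subalgebra_of_C_b X A \<and>
      topspace L \<noteq> {} \<and> locally_compact_space L \<and> Hausdorff_space L \<and>
      isometrically_isomorphic X A L (C_c L) \<and>
      (\<forall>Y :: 'b topology.
         topspace Y \<noteq> {} \<and> locally_compact_space Y \<and> Hausdorff_space Y \<and>
         isometrically_isomorphic X A Y (C_c Y) \<longrightarrow> Y homeomorphic_space L) \<and>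
      (unital X A \<longleftrightarrow> P X))"
  unfolding Let_def
proof (intro conjI allI impI)
  let ?A = "C_P P X :: ('a \<Rightarrow> 'k) set" and ?L = "lambda_P TYPE('k) P X"
  show "topspace ?L \<noteq> {}"
    using nonempty beta_embed_image_subset_lambda_P by blast
  fix Y :: "'b topology"
  assume "topspace Y \<noteq> {} \<and> locally_compact_space Y \<and> Hausdorff_space Y \<and>
    isometrically_isomorphic X ?A Y (C_c Y)"
  then have Y: "locally_compact_space Y" "Hausdorff_space Y" "isometrically_isomorphic Y (C_c Y) X ?A"
    by (auto intro: isometrically_isomorphic_sym subalgebra_C_P)
  show "Y homeomorphic_space ?L"
    by (rule C_c_determines_space[OF Y(1,2) locally_compact_lambda_P Hausdorff_lambda_P
          isometrically_isomorphic_trans[OF Y(3) isometrically_isomorphic_C_P_C_c_lambda_P]])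
qed (rule subalgebra_C_P locally_compact_lambda_P Hausdorff_lambda_P
    isometrically_isomorphic_C_P_C_c_lambda_P unital_C_P_iff)+

end

theorem theorem2p10:
  fixes P :: "'a topology \<Rightarrow> bool" and X :: "'a topology"
  assumes "topological_property P"
    and "closed_hereditary P"
    and "preserved_under_finite_closed_sums P"
    and "topspace X \<noteq> {}"
    and "normal_space X" and "Hausdorff_space X"
    and "locally_P P X"
  shows
    "(let A = (C_P P X :: ('a \<Rightarrow> real) set); L = lambda_P TYPE(real) P X in
        subalgebra_of_C_b X A \<and>
        topspace L \<noteq> {} \<and> locally_compact_space L \<and> Hausdorff_space L \<and>
        isometrically_isomorphic X A L (C_c L) \<and>
        (\<forall>Y :: 'b topology.
           topspace Y \<noteq> {} \<and> locally_compact_space Y \<and> Hausdorff_space Y \<and>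
           isometrically_isomorphic X A Y (C_c Y) \<longrightarrow> Y homeomorphic_space L) \<and>
        (unital X A \<longleftrightarrow> P X))
   \<and> (let A = (C_P P X :: ('a \<Rightarrow> complex) set); L = lambda_P TYPE(complex) P X in
        subalgebra_of_C_b X A \<and>
        topspace L \<noteq> {} \<and> locally_compact_space L \<and> Hausdorff_space L \<and>
        isometrically_isomorphic X A L (C_c L) \<and>
        (\<forall>Y :: 'b topology.
           topspace Y \<noteq> {} \<and> locally_compact_space Y \<and> Hausdorff_space Y \<and>
           isometrically_isomorphic X A Y (C_c Y) \<longrightarrow> Y homeomorphic_space L) \<and>
        (unital X A \<longleftrightarrow> P X))"
proof -
  interpret normal_locally_P P X
    by (rule normal_locally_P.intro) (fact assms)+
  show ?thesis
    by (intro conjI C_P_representation)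
qed

end
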